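(* Let $a,b>0$ and let $p_{a,b}(n)=1+an+bn^2$ for $n\in\mathbb N=\{0,1,2,\dots\}$. There exists $\epsilon_0\in(0,1)$ such that $\epsilon+b(2/\epsilon-1)>a$ for every $\epsilon\in(0,\epsilon_0)$. Fix any such $\epsilon_0$. For $\epsilon\in(0,\epsilon_0)$ put $K_\epsilon:=\epsilon^2-\epsilon(a+b)+2b$ (which is positive), and let $$\lambda_0:=\sqrt{1-\epsilon},\qquad \lambda_1:=\sqrt{\frac{\epsilon^3}{K_\epsilon}},\qquad \lambda_n:=\sqrt{\frac{p_{a,b}(n-1)}{p_{a,b}(n-2)}}\quad (n\geq 2).$$ Let $S_\epsilon$ be the operator on $\ell^2(\mathbb N)$ given by $(S_\epsilon f)(0)=\lambda_0 f(0)$ and $(S_\epsilon f)(n)=\lambda_n f(n-1)$ for $n\geq 1$; equivalently, $S_\epsilon e_0=\lambda_0e_0+\lambda_1e_1$ and $S_\epsilon e_n=\lambda_{n+1}e_{n+1}$ for $n\geq 1$, where $\{e_n\}_{n\in\mathbb N}$ is the standard orthonormal basis of $\ell^2(\mathbb N)$. Then for every $\epsilon\in(0,\epsilon_0)$, $S_\epsilon$ is a bounded left-invertible operator, it is cyclic with cyclic vector $e_0$, it satisfies $\|S_\epsilon f\|\geq\|f\|$ for all $f\in\ell^2(\mathbb N)$ orthogonal to $e_0$, and the following statements hold: (i) $S_\epsilon$ is an analytic $3$-isometry. (ii) $S_\epsilon$ is norm-increasing if and only if $K_\epsilon\leq\epsilon^2$. (iii) $S_\epsilon$ admits the wandering subspace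 property if and only if $$K_\epsilon<\frac{\epsilon^3}{\sqrt{1-\epsilon}\,\bigl(1-\sqrt{1-\epsilon}\bigr)}.$$ (iv) The Cauchy dual $S_\epsilon'$ of $S_\epsilon$ admits Wold-type decomposition if and only if the inequality in (iii) holds. Consequently: (v) For every $\epsilon\in(0,\epsilon_0)$, if $S_\epsilon$ is norm-increasing, then $S_\epsilon$ admits the wandering subspace property. (vi) There exists $\epsilon_1\in(0,\epsilon_0)$ such that for every $\epsilon\in(0,\epsilon_1)$, $S_\epsilon$ is an analytic $3$-isometry which does not admit the wandering subspace property. (vii) $\|S_\epsilon e_0\|^2=1-\epsilon+\epsilon^3/K_\epsilon$, and this converges to $1$ from below as $\epsilon\to0^+$.
   Context: For a bounded linear operator $T$ on a complex Hilbert space $\mathcal H$: $T$ is norm-increasing if $T^*T\geq I$. $T$ is a $3$-isometry if $\sum_{k=0}^3(-1)^k\binom3k T^{*k}T^k=0$. The hyper-range of $T$ is $T^\infty(\mathcal H)=\bigcap_{n\geq0}T^n\mathcal H$, and $T$ is analytic if its hyper-range is $\{0\}$. $T$ is left-invertible if there is a bounded $L$ with $LT=I$; in that case $T^*T$ is invertible and the Cauchy dual of $T$ is $T'=T(T^*T)^{-1}$. $T$ is cyclic with cyclic vector $x$ if the closed linear span of $\{T^nx:n\in\mathbb N\}$ is $\mathcal H$. $T$ admits the wandering subspace property if $[\ker T^*]_T=\mathcal H$, where $[\ker T^*]_T$ is the closed linear span of $\{T^nh:n\in\mathbb N,\ h\in\ker T^*\}$. A left-invertible $T$ admits Wold-type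 decomposition if $T=U\oplus A$ on $\mathcal H=\mathcal H_u\oplus\mathcal H_a$ (orthogonal direct sum; either summand may be zero), where $\mathcal H_u$ is the hyper-range of $T$, $U$ is unitary on $\mathcal H_u$, $A$ is analytic on $\mathcal H_a$, and $A$ admits the wandering subspace property. *)

theory Defs
  imports "HOL-Analysis.Analysis" "HOL-Library.Nonpos_Ints"
begin

text \<open>The inner product \<open>cinner\<close> is linear in the first argument. Through \<open>inner_cinner\<close> the norm
  inherited from \<^class>\<open>real_inner\<close> is \<open>norm x = sqrt (Re (cinner x x))\<close>, and definiteness of
  \<open>cinner\<close> is definiteness of its real part.\<close>

class chilbert = real_inner + complete_space +
  fixes scaleC :: "complex \<Rightarrow> 'a \<Rightarrow> 'a"  (infixr "*\<^sub>C" 75)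
    and cinner :: "'a \<Rightarrow> 'a \<Rightarrow> complex"
  assumes scaleC_add_right: "c *\<^sub>C (x + y) = c *\<^sub>C x + c *\<^sub>C y"
    and scaleC_add_left: "(c + d) *\<^sub>C x = c *\<^sub>C x + d *\<^sub>C x"
    and scaleC_scaleC: "c *\<^sub>C d *\<^sub>C x = (c * d) *\<^sub>C x"
    and scaleC_one: "1 *\<^sub>C x = x"
    and scaleR_scaleC: "r *\<^sub>R x = complex_of_real r *\<^sub>C x"
    and cinner_commute: "cinner x y = cnj (cinner y x)"
    and cinner_add_left: "cinner (x + y) z = cinner x z + cinner y z"
    and cinner_scaleC_left: "cinner (c *\<^sub>C x) y = c * cinner x y"
    and inner_cinner: "inner x y = Re (cinner x y)"

global_interpretation complex_vector: vector_space "scaleC :: complex \<Rightarrow> 'a \<Rightarrow> 'a::chilbert"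
  defines csubspace = complex_vector.subspace
    and cspan = complex_vector.span
  by unfold_locales (simp_all add: scaleC_add_right scaleC_add_left scaleC_scaleC scaleC_one)

definition bounded_clinear :: "('a::chilbert \<Rightarrow> 'b::chilbert) \<Rightarrow> bool" where
  "bounded_clinear T \<longleftrightarrow> bounded_linear T \<and> (\<forall>c x. T (c *\<^sub>C x) = c *\<^sub>C T x)"

text \<open>The notions needed for the summands of a decomposition \<open>T = U \<oplus> A\<close> take as an extra argument
  a closed subspace \<open>M\<close> with \<open>T ` M \<subseteq> M\<close>, and refer to the restriction of \<open>T\<close> to the Hilbert
  space \<open>M\<close>. Taking \<open>M = UNIV\<close> gives the notion for \<open>T\<close> itself.\<close>

definition adj_on :: "'a::chilbert set \<Rightarrow> ('a \<Rightarrow> 'a) \<Rightarrow> 'a \<Rightarrow> 'a" where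
  "adj_on M T y = (THE z. z \<in> M \<and> (\<forall>x\<in>M. cinner (T x) y = cinner x z))"

abbreviation adj :: "('a::chilbert \<Rightarrow> 'a) \<Rightarrow> 'a \<Rightarrow> 'a" where
  "adj T \<equiv> adj_on UNIV T"

definition op_le :: "('a::chilbert \<Rightarrow> 'a) \<Rightarrow> ('a \<Rightarrow> 'a) \<Rightarrow> bool" where
  "op_le A B \<longleftrightarrow> (\<forall>x. cinner (B x - A x) x \<in> \<real>\<^sub>\<ge>\<^sub>0)"

definition norm_increasing :: "('a::chilbert \<Rightarrow> 'a) \<Rightarrow> bool" where
  "norm_increasing T \<longleftrightarrow> op_le id (adj T \<circ> T)"

definition three_isometry :: "('a::chilbert \<Rightarrow> 'a) \<Rightarrow> bool" where
  "three_isometry T \<longleftrightarrow>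
    (\<forall>x. (\<Sum>k\<le>3. ((- 1) ^ k * real (3 choose k)) *\<^sub>R (adj T ^^ k) ((T ^^ k) x)) = 0)"

definition hyper_range_on :: "'a set \<Rightarrow> ('a \<Rightarrow> 'a) \<Rightarrow> 'a set" where
  "hyper_range_on M T = (\<Inter>n. (T ^^ n) ` M)"

definition analytic_op_on :: "'a::chilbert set \<Rightarrow> ('a \<Rightarrow> 'a) \<Rightarrow> bool" where
  "analytic_op_on M T \<longleftrightarrow> hyper_range_on M T = {0}"

definition left_invertible :: "('a::chilbert \<Rightarrow> 'a) \<Rightarrow> bool" where
  "left_invertible T \<longleftrightarrow> (\<exists>L. bounded_clinear L \<and> L \<circ> T = id)"

definition cauchy_dual :: "('a::chilbert \<Rightarrow> 'a) \<Rightarrow> 'a \<Rightarrow> 'a" where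
  "cauchy_dual T = T \<circ> inv (adj T \<circ> T)"

definition cyclic_vector :: "('a::chilbert \<Rightarrow> 'a) \<Rightarrow> 'a \<Rightarrow> bool" where
  "cyclic_vector T x \<longleftrightarrow> closure (cspan {(T ^^ n) x | n. True}) = UNIV"

definition wandering_property_on :: "'a::chilbert set \<Rightarrow> ('a \<Rightarrow> 'a) \<Rightarrow> bool" where
  "wandering_property_on M T \<longleftrightarrow>
    closure (cspan {(T ^^ n) h | n h. h \<in> M \<and> adj_on M T h = 0}) = M"

definition unitary_on :: "'a::chilbert set \<Rightarrow> ('a \<Rightarrow> 'a) \<Rightarrow> bool" where
  "unitary_on M T \<longleftrightarrow> (\<forall>x\<in>M. adj_on M T (T x) = x \<and> T (adj_on M T x) = x)"

abbreviation hyper_range :: "('a \<Rightarrow> 'a) \<Rightarrow> 'a set" where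
  "hyper_range T \<equiv> hyper_range_on UNIV T"

abbreviation analytic_op :: "('a::chilbert \<Rightarrow> 'a) \<Rightarrow> bool" where
  "analytic_op T \<equiv> analytic_op_on UNIV T"

abbreviation wandering_property :: "('a::chilbert \<Rightarrow> 'a) \<Rightarrow> bool" where
  "wandering_property T \<equiv> wandering_property_on UNIV T"

definition orthogonal_sum :: "'a::chilbert set \<Rightarrow> 'a set \<Rightarrow> bool" where
  "orthogonal_sum M N \<longleftrightarrow>
    csubspace M \<and> closed M \<and> csubspace N \<and> closed N \<and>
    (\<forall>x\<in>M. \<forall>y\<in>N. cinner x y = 0) \<and> (\<forall>z. \<exists>x\<in>M. \<exists>y\<in>N. z = x + y)"

definition wold_type_decomposition :: "('a::chilbert \<Rightarrow> 'a) \<Rightarrow> bool" where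
  "wold_type_decomposition T \<longleftrightarrow>
    bounded_clinear T \<and> left_invertible T \<and>
    (\<exists>Hu Ha. orthogonal_sum Hu Ha \<and> T ` Hu \<subseteq> Hu \<and> T ` Ha \<subseteq> Ha \<and>
      Hu = hyper_range T \<and> unitary_on Hu T \<and>
      analytic_op_on Ha T \<and> wandering_property_on Ha T)"

typedef ell2 = "{f :: nat \<Rightarrow> complex. summable (\<lambda>n. (cmod (f n))\<^sup>2)}"
  morphisms nth_ell2 Abs_ell2
  by (intro exI[of _ "\<lambda>_. 0"]) simp

setup_lifting type_definition_ell2

lemma square_summable_add:
  assumes "summable (\<lambda>n. (cmod (f n))\<^sup>2)" "summable (\<lambda>n. (cmod (g n))\<^sup>2)"
  shows "summable (\<lambda>n. (cmod (f n + g n))\<^sup>2)"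
proof (rule summable_comparison_test')
  show "summable (\<lambda>n. 2 * (cmod (f n))\<^sup>2 + 2 * (cmod (g n))\<^sup>2)"
    using assms by (intro summable_add summable_mult)
  fix n
  have "(cmod (f n + g n))\<^sup>2 \<le> (cmod (f n) + cmod (g n))\<^sup>2"
    by (intro power_mono norm_triangle_ineq) auto
  also have "\<dots> \<le> 2 * (cmod (f n))\<^sup>2 + 2 * (cmod (g n))\<^sup>2"
    using sum_squares_bound[of "cmod (f n)" "cmod (g n)"] by (simp add: power2_sum)
  finally show "norm ((cmod (f n + g n))\<^sup>2) \<le> 2 * (cmod (f n))\<^sup>2 + 2 * (cmod (g n))\<^sup>2"
    by simp
qed

lemma square_summable_scale:
  assumes "summable (\<lambda>n. (cmod (f n))\<^sup>2)"
  shows "summable (\<lambda>n. (cmod (c * f n))\<^sup>2)"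
  using summable_mult[OF assms, of "(cmod c)\<^sup>2"] by (simp add: norm_mult power_mult_distrib)

lemma square_summable_diff:
  assumes "summable (\<lambda>n. (cmod (f n))\<^sup>2)" "summable (\<lambda>n. (cmod (g n))\<^sup>2)"
  shows "summable (\<lambda>n. (cmod (f n - g n))\<^sup>2)"
  using square_summable_add[OF assms(1) square_summable_scale[OF assms(2), of "-1"]] by simp

lemma square_summable_mult_cnj:
  assumes "summable (\<lambda>n. (cmod (f n))\<^sup>2)" "summable (\<lambda>n. (cmod (g n))\<^sup>2)"
  shows "summable (\<lambda>n. f n * cnj (g n))"
proof (rule summable_comparison_test')
  show "summable (\<lambda>n. (cmod (f n))\<^sup>2 + (cmod (g n))\<^sup>2)"
    using assms by (intro summable_add)
  fix n
  have "2 * (cmod (f n) * cmod (g n)) \<le> (cmod (f n))\<^sup>2 + (cmod (g n))\<^sup>2"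
    using sum_squares_bound[of "cmod (f n)" "cmod (g n)"] by simp
  moreover have "0 \<le> cmod (f n) * cmod (g n)" by simp
  ultimately show "norm (f n * cnj (g n)) \<le> (cmod (f n))\<^sup>2 + (cmod (g n))\<^sup>2"
    unfolding norm_mult complex_mod_cnj by linarith
qed

lemma summable_nth_ell2: "summable (\<lambda>n. (cmod (nth_ell2 f n))\<^sup>2)"
  using nth_ell2[of f] by simp

instantiation ell2 :: real_inner
begin

lift_definition zero_ell2 :: ell2 is "\<lambda>_. 0" by simp
lift_definition plus_ell2 :: "ell2 \<Rightarrow> ell2 \<Rightarrow> ell2" is "\<lambda>f g n. f n + g n"
  by (rule square_summable_add)
lift_definition minus_ell2 :: "ell2 \<Rightarrow> ell2 \<Rightarrow> ell2" is "\<lambda>f g n. f n - g n"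
  by (rule square_summable_diff)
lift_definition uminus_ell2 :: "ell2 \<Rightarrow> ell2" is "\<lambda>f n. - f n" by simp
lift_definition scaleR_ell2 :: "real \<Rightarrow> ell2 \<Rightarrow> ell2" is "\<lambda>r f n. complex_of_real r * f n"
  by (rule square_summable_scale)

definition inner_ell2 :: "ell2 \<Rightarrow> ell2 \<Rightarrow> real" where
  "inner_ell2 f g = Re (\<Sum>n. nth_ell2 f n * cnj (nth_ell2 g n))"
definition norm_ell2 :: "ell2 \<Rightarrow> real" where
  "norm_ell2 f = sqrt (\<Sum>n. (cmod (nth_ell2 f n))\<^sup>2)"
definition sgn_ell2 :: "ell2 \<Rightarrow> ell2" where
  "sgn_ell2 f = inverse (norm f) *\<^sub>R f"
definition dist_ell2 :: "ell2 \<Rightarrow> ell2 \<Rightarrow> real" where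
  "dist_ell2 f g = norm (f - g)"
definition uniformity_ell2 :: "(ell2 \<times> ell2) filter" where
  "uniformity_ell2 = (INF e\<in>{0<..}. principal {(x, y). dist x y < e})"
definition open_ell2 :: "ell2 set \<Rightarrow> bool" where
  "open_ell2 U \<longleftrightarrow> (\<forall>x\<in>U. eventually (\<lambda>(x', y). x' = x \<longrightarrow> y \<in> U) uniformity)"

instance
proof
  fix f g h :: ell2 and r s :: real
  note sm = square_summable_mult_cnj[OF summable_nth_ell2 summable_nth_ell2]
  have "(\<Sum>n. nth_ell2 f n * cnj (nth_ell2 f n)) =
      complex_of_real (\<Sum>n. (cmod (nth_ell2 f n))\<^sup>2)"
    unfolding suminf_of_real[OF summable_nth_ell2[of f]] complex_norm_square ..
  then have sq: "inner f f = (\<Sum>n. (cmod (nth_ell2 f n))\<^sup>2)"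
    unfolding inner_ell2_def by (simp only: Re_complex_of_real)
  show "f + g + h = f + (g + h)" by transfer (simp add: add.assoc)
  show "f + g = g + f" by transfer (simp add: add.commute)
  show "0 + f = f" by transfer simp
  show "- f + f = 0" by transfer simp
  show "f - g = f + - g" by transfer simp
  show "r *\<^sub>R (f + g) = r *\<^sub>R f + r *\<^sub>R g" by transfer (simp add: distrib_left)
  show "(r + s) *\<^sub>R f = r *\<^sub>R f + s *\<^sub>R f" by transfer (simp add: distrib_right)
  show "r *\<^sub>R s *\<^sub>R f = (r * s) *\<^sub>R f" by transfer (simp add: mult.assoc)
  show "1 *\<^sub>R f = f" by transfer simp
  show "sgn f = inverse (norm f) *\<^sub>R f" by (rule sgn_ell2_def)
  show "dist f g = norm (f - g)" by (rule dist_ell2_def)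
  show "uniformity = (INF e\<in>{0<..}. principal {(x :: ell2, y). dist x y < e})"
    by (rule uniformity_ell2_def)
  show "open U \<longleftrightarrow> (\<forall>x\<in>U. eventually (\<lambda>(x', y). x' = x \<longrightarrow> y \<in> U) uniformity)"
    for U :: "ell2 set" by (rule open_ell2_def)
  show "inner f g = inner g f"
  proof -
    have "(\<Sum>n. nth_ell2 g n * cnj (nth_ell2 f n)) =
        cnj (\<Sum>n. nth_ell2 f n * cnj (nth_ell2 g n))"
      using bounded_linear.suminf[OF bounded_linear_cnj sm[of f g]] by (simp add: mult.commute)
    then show ?thesis by (simp add: inner_ell2_def)
  qed
  show "inner (f + g) h = inner f h + inner g h"
    by (simp add: inner_ell2_def plus_ell2.rep_eq distrib_right
        flip: suminf_add[OF sm[of f h] sm[of g h]])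
  show "inner (r *\<^sub>R f) g = r * inner f g"
    by (simp add: inner_ell2_def scaleR_ell2.rep_eq mult.assoc suminf_mult[OF sm[of f g]])
  show "0 \<le> inner f f"
    unfolding sq by (intro suminf_nonneg summable_nth_ell2) simp
  show "inner f f = 0 \<longleftrightarrow> f = 0"
    unfolding sq using suminf_eq_zero_iff[OF summable_nth_ell2[of f]]
    by (simp add: zero_ell2.rep_eq fun_eq_iff flip: nth_ell2_inject)
  show "norm f = sqrt (inner f f)"
    unfolding sq by (rule norm_ell2_def)
qed

end

lemma norm_ell2_square: "(norm f)\<^sup>2 = (\<Sum>n. (cmod (nth_ell2 f n))\<^sup>2)"
  unfolding norm_ell2_def by (intro real_sqrt_pow2 suminf_nonneg summable_nth_ell2) simp

lemma sum_nth_ell2_le: "(\<Sum>n<N. (cmod (nth_ell2 f n))\<^sup>2) \<le> (norm f)\<^sup>2"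
  unfolding norm_ell2_square by (intro sum_le_suminf summable_nth_ell2) auto

lemma cmod_nth_ell2_le: "cmod (nth_ell2 f n) \<le> norm f"
proof -
  have "(cmod (nth_ell2 f n))\<^sup>2 \<le> (\<Sum>k<Suc n. (cmod (nth_ell2 f k))\<^sup>2)"
    by (simp add: sum_nonneg)
  then have "(cmod (nth_ell2 f n))\<^sup>2 \<le> (norm f)\<^sup>2"
    using sum_nth_ell2_le[where N="Suc n" and f=f] by linarith
  then show ?thesis by (rule power2_le_imp_le) simp
qed

instance ell2 :: complete_space
proof
  fix X :: "nat \<Rightarrow> ell2"
  assume "Cauchy X"
  then have cauchy: "\<exists>M. \<forall>i\<ge>M. \<forall>j\<ge>M. norm (X i - X j) < e" if "e > 0" for e
    using that unfolding Cauchy_def dist_norm by blast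
  have "convergent (\<lambda>k. nth_ell2 (X k) n)" for n
  proof (rule Cauchy_convergent, unfold Cauchy_def dist_norm, intro allI impI)
    fix e :: real assume "e > 0"
    from cauchy[OF this] obtain M where M: "\<forall>i\<ge>M. \<forall>j\<ge>M. norm (X i - X j) < e" by blast
    have "cmod (nth_ell2 (X i) n - nth_ell2 (X j) n) < e" if "i \<ge> M" "j \<ge> M" for i j
      using M that cmod_nth_ell2_le[of "X i - X j" n] by (auto simp: minus_ell2.rep_eq
        intro: le_less_trans)
    then show "\<exists>M. \<forall>i\<ge>M. \<forall>j\<ge>M. cmod (nth_ell2 (X i) n - nth_ell2 (X j) n) < e" by blast
  qed
  then obtain g where g: "(\<lambda>k. nth_ell2 (X k) n) \<longlonglongrightarrow> g n" for n
    unfolding convergent_def by metis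
  have tail: "\<exists>M. \<forall>i\<ge>M. \<forall>N. (\<Sum>n<N. (cmod (nth_ell2 (X i) n - g n))\<^sup>2) \<le> e\<^sup>2"
    if "e > 0" for e
  proof -
    from cauchy[OF that] obtain M where M: "\<forall>i\<ge>M. \<forall>j\<ge>M. norm (X i - X j) < e" by blast
    have "(\<Sum>n<N. (cmod (nth_ell2 (X i) n - g n))\<^sup>2) \<le> e\<^sup>2" if i: "i \<ge> M" for i N
    proof (rule tendsto_upperbound)
      show "((\<lambda>j. \<Sum>n<N. (cmod (nth_ell2 (X i) n - nth_ell2 (X j) n))\<^sup>2)
          \<longlongrightarrow> (\<Sum>n<N. (cmod (nth_ell2 (X i) n - g n))\<^sup>2)) sequentially"
        by (intro tendsto_intros g)
      show "\<forall>\<^sub>F j in sequentially.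
          (\<Sum>n<N. (cmod (nth_ell2 (X i) n - nth_ell2 (X j) n))\<^sup>2) \<le> e\<^sup>2"
      proof (rule eventually_sequentiallyI)
        fix j assume "j \<ge> M"
        then have "norm (X i - X j) \<le> e" using M i by (simp add: less_imp_le)
        then have "(norm (X i - X j))\<^sup>2 \<le> e\<^sup>2" by (simp add: power_mono)
        then show "(\<Sum>n<N. (cmod (nth_ell2 (X i) n - nth_ell2 (X j) n))\<^sup>2) \<le> e\<^sup>2"
          using sum_nth_ell2_le[where N=N and f="X i - X j"] by (simp add: minus_ell2.rep_eq)
      qed
    qed simp
    then show ?thesis by blast
  qed
  obtain M0 where M0: "\<forall>N. (\<Sum>n<N. (cmod (nth_ell2 (X M0) n - g n))\<^sup>2) \<le> 1\<^sup>2"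
    using tail[of 1] by auto
  have "summable (\<lambda>n. (cmod (nth_ell2 (X M0) n - g n))\<^sup>2)"
    using M0 by (intro summableI_nonneg_bounded[where x=1]) auto
  from square_summable_diff[OF summable_nth_ell2[of "X M0"] this]
  have G: "nth_ell2 (Abs_ell2 g) = g" by (simp add: Abs_ell2_inverse)
  have "X \<longlonglongrightarrow> Abs_ell2 g"
  proof (rule metric_LIMSEQ_I)
    fix e :: real assume e: "e > 0"
    then obtain M where M: "\<forall>i\<ge>M. \<forall>N. (\<Sum>n<N. (cmod (nth_ell2 (X i) n - g n))\<^sup>2) \<le> (e/2)\<^sup>2"
      using tail[of "e/2"] by auto
    have "dist (X i) (Abs_ell2 g) < e" if "i \<ge> M" for i
    proof -
      have "(norm (X i - Abs_ell2 g))\<^sup>2 \<le> (e/2)\<^sup>2"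
        unfolding norm_ell2_square using M that
        by (intro suminf_le_const summable_nth_ell2) (auto simp: minus_ell2.rep_eq G)
      then have "norm (X i - Abs_ell2 g) \<le> e/2" by (rule power2_le_imp_le) (use e in simp)
      then show ?thesis using e by (simp add: dist_norm)
    qed
    then show "\<exists>M. \<forall>i\<ge>M. dist (X i) (Abs_ell2 g) < e" by blast
  qed
  then show "convergent X" by (rule convergentI)
qed

instantiation ell2 :: chilbert
begin

lift_definition scaleC_ell2 :: "complex \<Rightarrow> ell2 \<Rightarrow> ell2" is "\<lambda>c f n. c * f n"
  by (rule square_summable_scale)
definition cinner_ell2 :: "ell2 \<Rightarrow> ell2 \<Rightarrow> complex" where
  "cinner_ell2 f g = (\<Sum>n. nth_ell2 f n * cnj (nth_ell2 g n))"

instance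
proof
  fix f g h :: ell2 and c d :: complex and r :: real
  note sm = square_summable_mult_cnj[OF summable_nth_ell2 summable_nth_ell2]
  show "c *\<^sub>C (f + g) = c *\<^sub>C f + c *\<^sub>C g" by transfer (simp add: distrib_left)
  show "(c + d) *\<^sub>C f = c *\<^sub>C f + d *\<^sub>C f" by transfer (simp add: distrib_right)
  show "c *\<^sub>C d *\<^sub>C f = (c * d) *\<^sub>C f" by transfer (simp add: mult.assoc)
  show "1 *\<^sub>C f = f" by transfer simp
  show "r *\<^sub>R f = complex_of_real r *\<^sub>C f" by transfer simp
  show "cinner f g = cnj (cinner g f)"
    using bounded_linear.suminf[OF bounded_linear_cnj sm[of g f]]
    by (simp add: cinner_ell2_def mult.commute)
  show "cinner (f + g) h = cinner f h + cinner g h"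
    using suminf_add[OF sm[of f h] sm[of g h]]
    by (simp add: cinner_ell2_def plus_ell2.rep_eq distrib_right)
  show "cinner (c *\<^sub>C f) g = c * cinner f g"
    using suminf_mult[OF sm[of f g], of c]
    by (simp add: cinner_ell2_def scaleC_ell2.rep_eq mult.assoc)
  show "inner f g = Re (cinner f g)" by (simp add: inner_ell2_def cinner_ell2_def)
qed

end

lift_definition basis_ell2 :: "nat \<Rightarrow> ell2" is "\<lambda>n k. if k = n then 1 else 0"
proof -
  fix n :: nat
  show "summable (\<lambda>k. (cmod (if k = n then 1 else 0))\<^sup>2)"
    by (rule summable_finite[of "{n}"]) auto
qed

definition p_poly :: "real \<Rightarrow> real \<Rightarrow> nat \<Rightarrow> real" where
  "p_poly a b n = 1 + a * real n + b * (real n)\<^sup>2"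

definition K_eps :: "real \<Rightarrow> real \<Rightarrow> real \<Rightarrow> real" where
  "K_eps a b \<epsilon> = \<epsilon>\<^sup>2 - \<epsilon> * (a + b) + 2 * b"

definition weight :: "real \<Rightarrow> real \<Rightarrow> real \<Rightarrow> nat \<Rightarrow> real" where
  "weight a b \<epsilon> n =
    (if n = 0 then sqrt (1 - \<epsilon>)
     else if n = 1 then sqrt (\<epsilon> ^ 3 / K_eps a b \<epsilon>)
     else sqrt (p_poly a b (n - 1) / p_poly a b (n - 2)))"

text \<open>\<^const>\<open>Abs_ell2\<close> is only meaningful on square-summable sequences; these are obtained when the
  weights are bounded.\<close>

definition S_eps :: "real \<Rightarrow> real \<Rightarrow> real \<Rightarrow> ell2 \<Rightarrow> ell2" where
  "S_eps a b \<epsilon> f = Abs_ell2 (\<lambda>n.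
    if n = 0 then complex_of_real (weight a b \<epsilon> 0) * nth_ell2 f 0
    else complex_of_real (weight a b \<epsilon> n) * nth_ell2 f (n - 1))"

definition admissible :: "real \<Rightarrow> real \<Rightarrow> real \<Rightarrow> bool" where
  "admissible a b \<epsilon>0 \<longleftrightarrow>
    \<epsilon>0 \<in> {0<..<1} \<and> (\<forall>\<epsilon>\<in>{0<..<\<epsilon>0}. \<epsilon> + b * (2 / \<epsilon> - 1) > a)"

definition wandering_bound :: "real \<Rightarrow> real" where
  "wandering_bound \<epsilon> = \<epsilon> ^ 3 / (sqrt (1 - \<epsilon>) * (1 - sqrt (1 - \<epsilon>)))"

end

theory Submission
  imports Defs "HOL-Real_Asymp.Real_Asymp"
begin

text \<open>Write \<open>S\<close> for the operator with weights \<open>\<lambda>\<close>. All operators \<open>S\<^sup>*\<^sup>k S\<^sup>k\<close> are diagonal, which reduces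
  the statements about norms and the 3-isometry identity to scalar ones. The Cauchy dual \<open>S'\<close> is an
  operator of the same form, whose dual is \<open>S\<close> again.

  For any such operator a vector of the hyper-range is determined by its coordinate at \<open>0\<close>, and
  is a multiple of the formal eigenvector for the eigenvalue \<open>\<lambda>\<^sub>0\<close>. If the coordinates of that
  eigenvector are unbounded, then the operator is analytic and its Cauchy dual has the wandering
  subspace property. If they are square-summable, then both fail, and the operator has no Wold-type
  decomposition. For \<open>S\<close> the coordinates grow exponentially. For \<open>S'\<close> they are, up to a constant,
  \<open>r\<^sup>n / sqrt (p n)\<close> with \<open>r = (\<lambda>\<^sub>0\<^sup>2 + \<lambda>\<^sub>1\<^sup>2) / \<lambda>\<^sub>0\<close>; since \<open>\<Sum> 1 / p n\<close> converges, they are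
  square-summable for \<open>r \<le> 1\<close> and unbounded for \<open>r > 1\<close>, and \<open>r > 1\<close> is the inequality in (iii).\<close>

section \<open>Complex Hilbert spaces\<close>

lemma cinner_scaleC_right: "cinner x (c *\<^sub>C y) = cnj c * cinner x (y :: 'a::chilbert)"
  by (metis cinner_commute cinner_scaleC_left complex_cnj_mult)

lemma scaleC_minus_one: "- (x :: 'a::chilbert) = (-1) *\<^sub>C x"
  using scaleR_scaleC[of "-1" x] by simp

lemma cinner_diff_left: "cinner (x - y) z = cinner x z - cinner (y :: 'a::chilbert) z"
proof -
  have "cinner (- y) z = - cinner y z"
    unfolding scaleC_minus_one[of y] cinner_scaleC_left by simp
  then show ?thesis
    using cinner_add_left[of x "- y" z] by (simp only: diff_conv_add_uminus)
qed

lemma cinner_diff_right: "cinner x (y - z) = cinner x y - cinner x (z :: 'a::chilbert)"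
  by (metis cinner_diff_left cinner_commute complex_cnj_diff)

lemma cinner_zero_left [simp]: "cinner 0 (y :: 'a::chilbert) = 0"
  using cinner_diff_left[of 0 0 y] by simp

lemma cinner_zero_right [simp]: "cinner (y :: 'a::chilbert) 0 = 0"
  using cinner_diff_right[of y 0 0] by simp

lemma norm_square_cinner: "(norm (x :: 'a::chilbert))\<^sup>2 = Re (cinner x x)"
  by (simp add: power2_norm_eq_inner inner_cinner)

lemma cinner_self_eq_0_iff: "cinner x x = 0 \<longleftrightarrow> (x :: 'a::chilbert) = 0"
  by (metis cinner_zero_left inner_cinner inner_eq_zero_iff zero_complex.simps(1))

lemma norm_scaleC: "norm (c *\<^sub>C (x :: 'a::chilbert)) = cmod c * norm x"
proof -
  have "cinner (c *\<^sub>C x) (c *\<^sub>C x) = (c * cnj c) * cinner x x"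
    by (simp add: cinner_scaleC_left cinner_scaleC_right)
  also have "\<dots> = complex_of_real ((cmod c)\<^sup>2) * cinner x x"
    by (simp only: complex_norm_square)
  finally have "(norm (c *\<^sub>C x))\<^sup>2 = (cmod c * norm x)\<^sup>2"
    by (simp add: norm_square_cinner power_mult_distrib)
  then show ?thesis by simp
qed

lemma bounded_linear_scaleC: "bounded_linear (\<lambda>x :: 'a::chilbert. c *\<^sub>C x)"
  by (rule bounded_linear_intro[where K="cmod c"])
    (simp_all add: scaleC_add_right scaleR_scaleC scaleC_scaleC mult.commute norm_scaleC)

lemma csubspace_closure:
  assumes "csubspace (M :: 'a::chilbert set)"
  shows "csubspace (closure M)"
  unfolding complex_vector.subspace_def
proof (intro conjI ballI allI)
  show "0 \<in> closure M"
    using assms closure_subset complex_vector.subspace_0 by blast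
next
  fix x y assume "x \<in> closure M" "y \<in> closure M"
  then obtain X Y where "\<forall>n. X n \<in> M" "X \<longlonglongrightarrow> x" "\<forall>n. Y n \<in> M" "Y \<longlonglongrightarrow> y"
    unfolding closure_sequential by blast
  then show "x + y \<in> closure M"
    unfolding closure_sequential using assms
    by (intro exI[of _ "\<lambda>n. X n + Y n"]) (auto intro: tendsto_add complex_vector.subspace_add)
next
  fix c x assume "x \<in> closure M"
  then obtain X where "\<forall>n. X n \<in> M" "X \<longlonglongrightarrow> x"
    unfolding closure_sequential by blast
  then show "c *\<^sub>C x \<in> closure M"
    unfolding closure_sequential using assms
    by (intro exI[of _ "\<lambda>n. c *\<^sub>C X n"])
      (auto intro: bounded_linear.tendsto[OF bounded_linear_scaleC] complex_vector.subspace_scale)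
qed

lemma csubspace_orthogonal: "csubspace {x :: 'a::chilbert. cinner x g = 0}"
  by (auto simp: complex_vector.subspace_def cinner_add_left cinner_scaleC_left)

text \<open>The imaginary part of the complex product is, up to sign, the real part of the one with
  \<open>x\<close> multiplied by i. The condition thus splits into two real ones, and the real inner
  product is continuous.\<close>

lemma closed_orthogonal: "closed {x :: 'a::chilbert. cinner x g = 0}"
proof -
  have eq: "{x. cinner x g = 0} = {x. inner x g = 0} \<inter> {x. inner (\<i> *\<^sub>C x) g = 0}"
    by (auto simp: inner_cinner cinner_scaleC_left complex_eq_iff)
  have "closed {x. inner x g = 0}"
    by (intro closed_Collect_eq continuous_intros)
  moreover have "closed {x. inner (\<i> *\<^sub>C x) g = 0}"
    by (intro closed_Collect_eq continuous_intros
        bounded_linear.continuous_on[OF bounded_linear_scaleC])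
  ultimately show ?thesis unfolding eq by (rule closed_Int)
qed

text \<open>Two candidates differ by a vector of \<open>M\<close> that is orthogonal to itself, so
  exhibiting one candidate settles the definite description.\<close>

lemma adj_on_eqI:
  assumes "csubspace M" "z \<in> M" and "\<And>x. x \<in> M \<Longrightarrow> cinner (T x) y = cinner x z"
  shows "adj_on M T y = z"
  unfolding adj_on_def
proof (rule the_equality)
  show "z \<in> M \<and> (\<forall>x\<in>M. cinner (T x) y = cinner x z)" using assms by blast
next
  fix z' assume z': "z' \<in> M \<and> (\<forall>x\<in>M. cinner (T x) y = cinner x z')"
  have "z' - z \<in> M" using assms z' complex_vector.subspace_diff by blast
  then have "cinner (z' - z) (z' - z) = 0"
    using assms(3)[of "z' - z"] z' by (simp add: cinner_diff_right)
  then show "z' = z" by (simp add: cinner_self_eq_0_iff)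
qed

lemma adj_eqI:
  assumes "\<And>x y. cinner (T x) y = cinner x (R y)"
  shows "adj T = R"
  by (rule ext, rule adj_on_eqI) (use assms in \<open>auto simp: complex_vector.subspace_def\<close>)

lemma cspan_invariant:
  assumes "bounded_clinear T" and "\<And>x. x \<in> A \<Longrightarrow> T x \<in> cspan A" and "x \<in> cspan A"
  shows "T x \<in> cspan A"
proof -
  interpret T: bounded_linear T using assms(1) by (simp add: bounded_clinear_def)
  have "csubspace {x. T x \<in> cspan A}"
    using assms(1) by (auto simp: complex_vector.subspace_def T.add T.zero bounded_clinear_def
        complex_vector.span_zero complex_vector.span_add complex_vector.span_scale)
  then have "cspan A \<subseteq> {x. T x \<in> cspan A}"
    using assms(2) by (intro complex_vector.span_minimal) auto
  then show ?thesis using assms(3) by blast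
qed

section \<open>The sequence space\<close>

lemmas nth_ell2_simps [simp] =
  zero_ell2.rep_eq plus_ell2.rep_eq minus_ell2.rep_eq uminus_ell2.rep_eq
  scaleR_ell2.rep_eq scaleC_ell2.rep_eq basis_ell2.rep_eq

lemma ell2_eqI:
  assumes "\<And>n. nth_ell2 f n = nth_ell2 g n"
  shows "f = g"
  using assms by (auto simp: fun_eq_iff simp flip: nth_ell2_inject)

lemma nth_Abs_ell2:
  assumes "summable (\<lambda>n. (cmod (f n))\<^sup>2)"
  shows "nth_ell2 (Abs_ell2 f) = f"
  using assms by (simp add: Abs_ell2_inverse)

lemma cinner_basis_right: "cinner f (basis_ell2 n) = nth_ell2 f n"
proof -
  have "(\<Sum>k. nth_ell2 f k * cnj (nth_ell2 (basis_ell2 n) k)) = (\<Sum>k\<in>{n}. nth_ell2 f k)"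
    by (subst suminf_finite[of "{n}"]) auto
  then show ?thesis by (simp add: cinner_ell2_def)
qed

lemma cinner_basis_left: "cinner (basis_ell2 n) f = cnj (nth_ell2 f n)"
  by (metis cinner_basis_right cinner_commute)

lemma norm_basis_ell2: "norm (basis_ell2 n) = 1"
  by (rule power2_eq_imp_eq) (simp_all add: norm_square_cinner cinner_basis_right)

text \<open>Truncations of \<open>f\<close> lie in \<open>M\<close> and converge to
  \<open>f\<close>, since the squared error is a tail of the series for the squared norm.\<close>

lemma closed_csubspace_basis_eq_UNIV:
  assumes "csubspace M" "closed M" "\<And>n. basis_ell2 n \<in> M"
  shows "M = UNIV"
proof -
  have "f \<in> M" for f
  proof -
    define P where "P N = (\<Sum>k<N. nth_ell2 f k *\<^sub>C basis_ell2 k)" for N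
    have nth_P: "nth_ell2 (P N) n = (if n < N then nth_ell2 f n else 0)" for N n
    proof -
      have "nth_ell2 (P N) n = (\<Sum>k<N. if k = n then nth_ell2 f k else 0)"
        unfolding P_def by (induction N) auto
      then show ?thesis by simp
    qed
    have P: "P N \<in> M" for N
      unfolding P_def using assms
      by (intro complex_vector.subspace_sum complex_vector.subspace_scale) auto
    have "P \<longlonglongrightarrow> f"
    proof (rule metric_LIMSEQ_I)
      fix e :: real assume e: "e > 0"
      then obtain N where N: "\<And>n. n \<ge> N \<Longrightarrow> norm (\<Sum>i. (cmod (nth_ell2 f (i + n)))\<^sup>2) < e\<^sup>2"
        using suminf_exist_split[OF _ summable_nth_ell2[of f], of "e\<^sup>2"] by auto
      have "dist (P n) f < e" if "n \<ge> N" for n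
      proof -
        have "(norm (P n - f))\<^sup>2 = (\<Sum>i. (cmod (nth_ell2 (P n - f) (i + n)))\<^sup>2)
            + (\<Sum>i<n. (cmod (nth_ell2 (P n - f) i))\<^sup>2)"
          unfolding norm_ell2_square by (rule suminf_split_initial_segment[OF summable_nth_ell2])
        also have "\<dots> = (\<Sum>i. (cmod (nth_ell2 f (i + n)))\<^sup>2)"
          by (simp add: nth_P)
        also have "\<dots> < e\<^sup>2" using N[OF that] by simp
        finally show ?thesis using e by (simp add: dist_norm power_less_imp_less_base)
      qed
      then show "\<exists>N. \<forall>n\<ge>N. dist (P n) f < e" by blast
    qed
    then show "f \<in> M"
      using P assms(2) closed_sequentially by blast
  qed
  then show ?thesis by blast
qed

lemma closure_cspan_eq_UNIV:
  assumes "\<And>n. basis_ell2 n \<in> closure (cspan A)"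
  shows "closure (cspan A) = UNIV"
  using assms by (intro closed_csubspace_basis_eq_UNIV csubspace_closure) auto

section \<open>Diagonal operators with bounded real entries\<close>

definition diag_op :: "(nat \<Rightarrow> real) \<Rightarrow> ell2 \<Rightarrow> ell2" where
  "diag_op d f = Abs_ell2 (\<lambda>n. complex_of_real (d n) * nth_ell2 f n)"

lemma square_summable_mult_bounded:
  assumes "bounded (range d)" "summable (\<lambda>n. (cmod (f n))\<^sup>2)"
  shows "summable (\<lambda>n. (cmod (complex_of_real (d n) * f n))\<^sup>2)"
proof -
  obtain C where C: "\<And>n. \<bar>d n\<bar> \<le> C" using assms(1) by (auto simp: bounded_iff)
  show ?thesis
  proof (rule summable_comparison_test')
    show "summable (\<lambda>n. C\<^sup>2 * (cmod (f n))\<^sup>2)" by (intro summable_mult assms)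
    fix n
    have "\<bar>d n\<bar>\<^sup>2 \<le> C\<^sup>2" using C[of n] by (intro power_mono) auto
    then show "norm ((cmod (complex_of_real (d n) * f n))\<^sup>2) \<le> C\<^sup>2 * (cmod (f n))\<^sup>2"
      by (simp add: norm_mult power_mult_distrib mult_right_mono)
  qed
qed

lemma nth_diag_op:
  assumes "bounded (range d)"
  shows "nth_ell2 (diag_op d f) n = complex_of_real (d n) * nth_ell2 f n"
  unfolding diag_op_def
  by (subst nth_Abs_ell2[OF square_summable_mult_bounded[OF assms summable_nth_ell2]]) simp

lemma diag_op_one: "diag_op (\<lambda>_. 1) f = f"
  by (rule ell2_eqI) (simp add: nth_diag_op)

lemma summable_diag_form:
  assumes "bounded (range d)"
  shows "summable (\<lambda>n. d n * (cmod (nth_ell2 f n))\<^sup>2)"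
proof -
  obtain C where C: "\<And>n. \<bar>d n\<bar> \<le> C" using assms by (auto simp: bounded_iff)
  show ?thesis
    by (rule summable_comparison_test'[where g="\<lambda>n. C * (cmod (nth_ell2 f n))\<^sup>2"])
      (use C in \<open>auto intro: summable_mult summable_nth_ell2 mult_right_mono simp: abs_mult\<close>)
qed

lemma cinner_diag_op:
  assumes "bounded (range d)"
  shows "cinner (diag_op d f) f = complex_of_real (\<Sum>n. d n * (cmod (nth_ell2 f n))\<^sup>2)"
proof -
  have "cinner (diag_op d f) f = (\<Sum>n. complex_of_real (d n * (cmod (nth_ell2 f n))\<^sup>2))"
    unfolding cinner_ell2_def nth_diag_op[OF assms]
    by (simp only: of_real_mult complex_norm_square mult.assoc)
  then show ?thesis by (simp only: suminf_of_real[OF summable_diag_form[OF assms]])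
qed

lemma bounded_clinear_diag_op:
  assumes "bounded (range d)"
  shows "bounded_clinear (diag_op d)"
  unfolding bounded_clinear_def
proof (intro conjI allI)
  obtain C where C: "\<And>n. \<bar>d n\<bar> \<le> C" using assms by (auto simp: bounded_iff)
  show "bounded_linear (diag_op d)"
  proof (rule bounded_linear_intro)
    fix f
    have "(norm (diag_op d f))\<^sup>2 \<le> (\<Sum>n. C\<^sup>2 * (cmod (nth_ell2 f n))\<^sup>2)"
      unfolding norm_ell2_square
    proof (intro suminf_le summable_nth_ell2 summable_mult)
      fix n
      have "\<bar>d n\<bar>\<^sup>2 \<le> C\<^sup>2" using C[of n] by (intro power_mono) auto
      then show "(cmod (nth_ell2 (diag_op d f) n))\<^sup>2 \<le> C\<^sup>2 * (cmod (nth_ell2 f n))\<^sup>2"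
        by (simp add: nth_diag_op[OF assms] norm_mult power_mult_distrib mult_right_mono)
    qed
    also have "\<dots> = (norm f * C)\<^sup>2"
      by (simp add: suminf_mult summable_nth_ell2 norm_ell2_square power_mult_distrib mult.commute)
    finally show "norm (diag_op d f) \<le> norm f * C"
      by (rule power2_le_imp_le) (use C[of 0] in auto)
  next
    show "diag_op d (f + g) = diag_op d f + diag_op d g" for f g
      by (rule ell2_eqI) (simp add: nth_diag_op[OF assms] distrib_left)
    show "diag_op d (r *\<^sub>R f) = r *\<^sub>R diag_op d f" for r f
      by (rule ell2_eqI) (simp add: nth_diag_op[OF assms])
  qed
  show "diag_op d (c *\<^sub>C x) = c *\<^sub>C diag_op d x" for c x
    by (rule ell2_eqI) (simp add: nth_diag_op[OF assms])
qed

section \<open>Unilateral weighted shifts with an additional diagonal entry\<close>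

text \<open>The form of \<open>S_eps\<close> with arbitrary weights, so that the Cauchy dual is
  covered by the same results.\<close>

definition wshift :: "(nat \<Rightarrow> real) \<Rightarrow> ell2 \<Rightarrow> ell2" where
  "wshift w f = Abs_ell2 (\<lambda>n.
    if n = 0 then complex_of_real (w 0) * nth_ell2 f 0
    else complex_of_real (w n) * nth_ell2 f (n - 1))"

definition wshift_adj :: "(nat \<Rightarrow> real) \<Rightarrow> ell2 \<Rightarrow> ell2" where
  "wshift_adj w f = Abs_ell2 (\<lambda>n.
    if n = 0 then complex_of_real (w 0) * nth_ell2 f 0 + complex_of_real (w 1) * nth_ell2 f 1
    else complex_of_real (w (Suc n)) * nth_ell2 f (Suc n))"

lemma bounded_range_Suc: "bounded (range w) \<Longrightarrow> bounded (range (\<lambda>n. w (Suc n)))"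
  by (rule bounded_subset) auto

context
  fixes w :: "nat \<Rightarrow> real"
  assumes bw: "bounded (range w)"
begin

lemma nth_wshift:
  "nth_ell2 (wshift w f) = (\<lambda>n. if n = 0 then complex_of_real (w 0) * nth_ell2 f 0
    else complex_of_real (w n) * nth_ell2 f (n - 1))"
proof -
  have "summable (\<lambda>n. (cmod (complex_of_real (w (Suc n)) * nth_ell2 f n))\<^sup>2)"
    by (rule square_summable_mult_bounded[OF bounded_range_Suc[OF bw] summable_nth_ell2])
  then show ?thesis
    unfolding wshift_def by (intro nth_Abs_ell2, subst summable_Suc_iff[symmetric]) simp
qed

lemma nth_wshift_0 [simp]: "nth_ell2 (wshift w f) 0 = complex_of_real (w 0) * nth_ell2 f 0"
  and nth_wshift_Suc [simp]:
    "nth_ell2 (wshift w f) (Suc n) = complex_of_real (w (Suc n)) * nth_ell2 f n"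
  by (simp_all add: nth_wshift)

lemma nth_wshift_adj:
  "nth_ell2 (wshift_adj w f) = (\<lambda>n. if n = 0
    then complex_of_real (w 0) * nth_ell2 f 0 + complex_of_real (w 1) * nth_ell2 f 1
    else complex_of_real (w (Suc n)) * nth_ell2 f (Suc n))"
proof -
  have "summable (\<lambda>n. (cmod (complex_of_real (w (Suc (Suc n))) * nth_ell2 f (Suc (Suc n))))\<^sup>2)"
    by (intro square_summable_mult_bounded bounded_range_Suc bw)
      (simp add: summable_Suc_iff[of "\<lambda>n. (cmod (nth_ell2 f (Suc n)))\<^sup>2"]
        summable_Suc_iff[of "\<lambda>n. (cmod (nth_ell2 f n))\<^sup>2"] summable_nth_ell2)
  then show ?thesis
    unfolding wshift_adj_def by (intro nth_Abs_ell2, subst summable_Suc_iff[symmetric]) simp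
qed

lemma nth_wshift_adj_0 [simp]: "nth_ell2 (wshift_adj w f) 0 =
    complex_of_real (w 0) * nth_ell2 f 0 + complex_of_real (w (Suc 0)) * nth_ell2 f (Suc 0)"
  and nth_wshift_adj_Suc [simp]: "nth_ell2 (wshift_adj w f) (Suc n) =
    complex_of_real (w (Suc (Suc n))) * nth_ell2 f (Suc (Suc n))"
  by (simp_all add: nth_wshift_adj)

lemma wshift_add: "wshift w (f + g) = wshift w f + wshift w g"
  by (rule ell2_eqI) (simp add: nth_wshift distrib_left)

lemma wshift_scaleC: "wshift w (c *\<^sub>C f) = c *\<^sub>C wshift w f"
  by (rule ell2_eqI) (simp add: nth_wshift)

lemma wshift_adj_add: "wshift_adj w (f + g) = wshift_adj w f + wshift_adj w g"
  by (rule ell2_eqI) (simp add: nth_wshift_adj distrib_left)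

lemma wshift_adj_scaleC: "wshift_adj w (c *\<^sub>C f) = c *\<^sub>C wshift_adj w f"
  by (rule ell2_eqI) (simp add: nth_wshift_adj distrib_left)

text \<open>The two series agree after regrouping: terms 0 and 1 on the left make up term 0 on the
  right, and the later terms match with a shift by one.\<close>

lemma cinner_wshift: "cinner (wshift w f) g = cinner f (wshift_adj w g)"
proof -
  define u where "u n = nth_ell2 (wshift w f) n * cnj (nth_ell2 g n)" for n
  define v where "v n = nth_ell2 f n * cnj (nth_ell2 (wshift_adj w g) n)" for n
  have u: "summable u" and v: "summable v"
    unfolding u_def v_def by (intro square_summable_mult_cnj summable_nth_ell2)+
  have shift: "u (Suc (Suc n)) = v (Suc n)" for n
    by (simp add: u_def v_def)
  have "suminf u = (\<Sum>n. u (Suc (Suc n))) + u (Suc 0) + u 0"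
    using suminf_split_head[OF u] suminf_split_head[of "\<lambda>n. u (Suc n)"] u
    by (simp add: summable_Suc_iff)
  also have "\<dots> = (\<Sum>n. v (Suc n)) + v 0"
    by (simp only: shift) (simp add: u_def v_def distrib_left)
  also have "\<dots> = suminf v"
    using suminf_split_head[OF v] by simp
  finally show ?thesis by (simp only: cinner_ell2_def u_def[abs_def] v_def[abs_def])
qed

lemma adj_wshift: "adj (wshift w) = wshift_adj w"
  by (rule adj_eqI) (rule cinner_wshift)

end

section \<open>Diagonality of the Gram operators\<close>

text \<open>The diagonal of the operator obtained by applying \<open>wshift w\<close>, then
  \<open>diag_op d\<close>, then the adjoint. It is diagonal because the images of the basis vectors
  have the disjoint supports {0,1}, {2}, {3} and so on; only entry 0 mixes two values of
  \<open>d\<close>.\<close>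

definition conj_diag :: "(nat \<Rightarrow> real) \<Rightarrow> (nat \<Rightarrow> real) \<Rightarrow> nat \<Rightarrow> real" where
  "conj_diag w d n = (if n = 0 then (w 0)\<^sup>2 * d 0 + (w 1)\<^sup>2 * d 1 else (w (Suc n))\<^sup>2 * d (Suc n))"

abbreviation gram :: "(nat \<Rightarrow> real) \<Rightarrow> nat \<Rightarrow> real" where
  "gram w \<equiv> conj_diag w (\<lambda>_. 1)"

lemma gram_0: "gram w 0 = (w 0)\<^sup>2 + (w 1)\<^sup>2"
  by (simp add: conj_diag_def)

lemma gram_Suc: "gram w (Suc n) = (w (Suc (Suc n)))\<^sup>2"
  by (simp add: conj_diag_def)

context
  fixes w :: "nat \<Rightarrow> real"
  assumes bw: "bounded (range w)"
begin

lemma bounded_conj_diag: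
  assumes "bounded (range d)"
  shows "bounded (range (conj_diag w d))"
proof -
  obtain C D where C: "\<And>n. \<bar>w n\<bar> \<le> C" and D: "\<And>n. \<bar>d n\<bar> \<le> D"
    using bw assms by (auto simp: bounded_iff)
  have *: "\<bar>(w n)\<^sup>2 * d n\<bar> \<le> C\<^sup>2 * D" for n
  proof -
    have "\<bar>w n\<bar>\<^sup>2 \<le> C\<^sup>2" using C[of n] by (intro power_mono) auto
    then show ?thesis using D[of n] by (simp add: abs_mult mult_mono)
  qed
  have "\<bar>conj_diag w d n\<bar> \<le> C\<^sup>2 * D + C\<^sup>2 * D" for n
  proof -
    have "conj_diag w d n = (w 0)\<^sup>2 * d 0 + (w 1)\<^sup>2 * d 1
        \<or> conj_diag w d n = (w (Suc n))\<^sup>2 * d (Suc n)"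
      by (simp add: conj_diag_def)
    then show ?thesis using *[of 0] *[of 1] *[of "Suc n"] by linarith
  qed
  then show ?thesis by (auto simp: bounded_iff)
qed

lemma bounded_gram: "bounded (range (gram w))"
  by (rule bounded_conj_diag) simp

lemma wshift_adj_diag_wshift:
  assumes "bounded (range d)"
  shows "wshift_adj w (diag_op d (wshift w f)) = diag_op (conj_diag w d) f"
proof (rule ell2_eqI)
  fix n
  show "nth_ell2 (wshift_adj w (diag_op d (wshift w f))) n = nth_ell2 (diag_op (conj_diag w d) f) n"
    by (cases n) (simp_all add: bw nth_diag_op[OF assms] nth_diag_op[OF bounded_conj_diag[OF assms]] conj_diag_def
        power2_eq_square distrib_right)
qed

lemma wshift_adj_wshift: "wshift_adj w (wshift w f) = diag_op (gram w) f"
  using wshift_adj_diag_wshift[of "\<lambda>_. 1" f] by (simp add: diag_op_one)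

lemma norm_wshift_square: "(norm (wshift w f))\<^sup>2 = (\<Sum>n. gram w n * (cmod (nth_ell2 f n))\<^sup>2)"
proof -
  have "cinner (wshift w f) (wshift w f) = cnj (cinner (diag_op (gram w) f) f)"
    unfolding cinner_wshift[OF bw] wshift_adj_wshift by (rule cinner_commute)
  then show ?thesis
    by (simp add: norm_square_cinner cinner_diag_op[OF bounded_gram])
qed

lemma bounded_clinear_wshift: "bounded_clinear (wshift w)"
  unfolding bounded_clinear_def
proof (intro conjI allI)
  obtain C where C: "\<And>n. \<bar>gram w n\<bar> \<le> C" using bounded_gram by (auto simp: bounded_iff)
  have C0: "C \<ge> 0" using C[of 0] by linarith
  show "bounded_linear (wshift w)"
  proof (rule bounded_linear_intro)
    fix f
    have "(norm (wshift w f))\<^sup>2 \<le> (\<Sum>n. C * (cmod (nth_ell2 f n))\<^sup>2)"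
      unfolding norm_wshift_square
      using C by (intro suminf_le summable_mult summable_diag_form bounded_gram summable_nth_ell2
          mult_right_mono) (auto simp: abs_le_iff)
    also have "\<dots> = (norm f * sqrt C)\<^sup>2"
      using C0 by (simp add: suminf_mult summable_nth_ell2 norm_ell2_square power_mult_distrib)
    finally show "norm (wshift w f) \<le> norm f * sqrt C"
      by (rule power2_le_imp_le) (use C0 in auto)
  qed (simp_all only: wshift_add[OF bw] scaleR_scaleC wshift_scaleC[OF bw])
qed (rule wshift_scaleC[OF bw])

text \<open>If g is the image of f under the adjoint, its squared norm is the inner product of
  \<open>wshift w g\<close> with f. Cauchy-Schwarz and the bound for \<open>wshift w\<close> then
  allow one factor \<open>norm g\<close> to be cancelled.\<close>

lemma bounded_clinear_wshift_adj: "bounded_clinear (wshift_adj w)"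
  unfolding bounded_clinear_def
proof (intro conjI allI)
  obtain C where C: "C > 0" "\<And>f. norm (wshift w f) \<le> norm f * C"
    using bounded_clinear_wshift bounded_linear.pos_bounded unfolding bounded_clinear_def by blast
  show "bounded_linear (wshift_adj w)"
  proof (rule bounded_linear_intro)
    fix f
    let ?g = "wshift_adj w f"
    have "norm ?g * norm ?g = Re (cinner (wshift w ?g) f)"
      by (simp add: cinner_wshift[OF bw] flip: norm_square_cinner power2_eq_square)
    also have "\<dots> \<le> norm (wshift w ?g) * norm f"
      by (metis inner_cinner norm_cauchy_schwarz)
    also have "\<dots> \<le> norm ?g * (norm f * C)"
      using mult_right_mono[OF C(2)[of ?g], of "norm f"] by (simp add: mult_ac)
    finally show "norm ?g \<le> norm f * C"
      using C(1) by (cases "norm ?g = 0") auto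
  qed (simp_all only: wshift_adj_add[OF bw] scaleR_scaleC wshift_adj_scaleC[OF bw])
qed (rule wshift_adj_scaleC[OF bw])

lemma norm_increasing_wshift_iff: "norm_increasing (wshift w) \<longleftrightarrow> (\<forall>n. gram w n \<ge> 1)"
proof -
  have b: "bounded (range (\<lambda>n. gram w n - 1))"
    using bounded_minus_comp[OF bounded_gram, of "\<lambda>_. 1"] by simp
  have eq: "diag_op (gram w) f - f = diag_op (\<lambda>n. gram w n - 1) f" for f
    by (rule ell2_eqI) (simp add: nth_diag_op b bounded_gram left_diff_distrib)
  have ni: "norm_increasing (wshift w) \<longleftrightarrow>
      (\<forall>f. (\<Sum>n. (gram w n - 1) * (cmod (nth_ell2 f n))\<^sup>2) \<ge> 0)"
    by (simp add: norm_increasing_def op_le_def adj_wshift[OF bw] wshift_adj_wshift eq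
        cinner_diag_op[OF b])
  show ?thesis unfolding ni
  proof (intro iffI allI)
    fix n assume "\<forall>f. (\<Sum>n. (gram w n - 1) * (cmod (nth_ell2 f n))\<^sup>2) \<ge> 0"
    then have "(\<Sum>k. (gram w k - 1) * (cmod (nth_ell2 (basis_ell2 n) k))\<^sup>2) \<ge> 0" by blast
    also have "(\<Sum>k. (gram w k - 1) * (cmod (nth_ell2 (basis_ell2 n) k))\<^sup>2) = gram w n - 1"
      by (subst suminf_finite[of "{n}"]) auto
    finally show "gram w n \<ge> 1" by simp
  next
    fix f assume "\<forall>n. gram w n \<ge> 1"
    then show "(\<Sum>n. (gram w n - 1) * (cmod (nth_ell2 f n))\<^sup>2) \<ge> 0"
      by (intro suminf_nonneg summable_diag_form b) auto
  qed
qed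

text \<open>Iterated conjugation makes every summand diagonal, so the operator identity reduces to
  one scalar identity per coordinate.\<close>

lemma three_isometry_wshift:
  assumes "\<And>n. (\<Sum>k\<le>3. (- 1) ^ k * real (3 choose k) * (conj_diag w ^^ k) (\<lambda>_. 1) n) = 0"
  shows "three_isometry (wshift w)"
proof -
  have bd: "bounded (range ((conj_diag w ^^ k) (\<lambda>_. 1)))" for k
    by (induction k) (auto intro: bounded_conj_diag)
  have pow: "(wshift_adj w ^^ k) ((wshift w ^^ k) f) = diag_op ((conj_diag w ^^ k) (\<lambda>_. 1)) f"
    for k f
  proof (induction k arbitrary: f)
    case (Suc k)
    \<comment> \<open>One adjoint is split off on the outside and one shift on the inside, so that
      the induction hypothesis applies to \<open>wshift w f\<close>.\<close>
    have "(wshift_adj w ^^ Suc k) ((wshift w ^^ Suc k) f) =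
        wshift_adj w ((wshift_adj w ^^ k) ((wshift w ^^ k) (wshift w f)))"
      by (simp add: funpow_swap1)
    then show ?case by (simp add: Suc wshift_adj_diag_wshift[OF bd])
  qed (simp add: diag_op_one)
  have nth_sum: "nth_ell2 (\<Sum>k\<in>A. c k *\<^sub>R F k) n = (\<Sum>k\<in>A. complex_of_real (c k) * nth_ell2 (F k) n)"
    for A :: "nat set" and c F n
    by (induction A rule: infinite_finite_induct) auto
  have "(\<Sum>k\<le>3. ((- 1) ^ k * real (3 choose k)) *\<^sub>R (wshift_adj w ^^ k) ((wshift w ^^ k) f)) = 0" for f
  proof (rule ell2_eqI)
    fix n
    have "nth_ell2 (\<Sum>k\<le>3. ((- 1) ^ k * real (3 choose k)) *\<^sub>R
        (wshift_adj w ^^ k) ((wshift w ^^ k) f)) n =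
      complex_of_real (\<Sum>k\<le>3. (- 1) ^ k * real (3 choose k) * (conj_diag w ^^ k) (\<lambda>_. 1) n)
        * nth_ell2 f n"
      unfolding nth_sum pow nth_diag_op[OF bd] of_real_sum sum_distrib_right
      by (simp only: of_real_mult mult.assoc)
    then show "nth_ell2 (\<Sum>k\<le>3. ((- 1) ^ k * real (3 choose k)) *\<^sub>R
        (wshift_adj w ^^ k) ((wshift w ^^ k) f)) n = nth_ell2 0 n"
      by (simp only: assms) simp
  qed
  then show ?thesis by (simp only: three_isometry_def adj_wshift[OF bw]) simp
qed

end

section \<open>Left inverses, Cauchy duals and the hyper-range\<close>

text \<open>The upper bound makes the shift bounded, the lower one makes its Gram operator boundedly
  invertible; together they pass to the dual weights.\<close>

definition bounded_weights :: "(nat \<Rightarrow> real) \<Rightarrow> bool" where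
  "bounded_weights w \<longleftrightarrow> bounded (range w) \<and> (\<exists>c>0. \<forall>n. c \<le> w n)"

text \<open>Truncated subtraction is intended: the weights with indices \<open>0\<close> and \<open>1\<close> are both divided by
  \<open>gram w 0\<close>.\<close>

definition dual_weights :: "(nat \<Rightarrow> real) \<Rightarrow> nat \<Rightarrow> real" where
  "dual_weights w n = w n / gram w (n - 1)"

text \<open>The coordinates of the formal eigenvector of \<^term>\<open>wshift w\<close> for the eigenvalue \<^term>\<open>w 0\<close>.\<close>

primrec eig_seq :: "(nat \<Rightarrow> real) \<Rightarrow> nat \<Rightarrow> real" where
  "eig_seq w 0 = 1"
| "eig_seq w (Suc n) = w (Suc n) / w 0 * eig_seq w n"

text \<open>Meaningful only when \<open>eig_seq w\<close> is square-summable; its coordinates are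
  computed under that assumption.\<close>

definition eig_vec :: "(nat \<Rightarrow> real) \<Rightarrow> ell2" where
  "eig_vec w = Abs_ell2 (\<lambda>n. complex_of_real (eig_seq w n))"

context
  fixes w :: "nat \<Rightarrow> real"
  assumes w: "bounded_weights w"
begin

lemma bounded_range_weights: "bounded (range w)"
  using w by (simp add: bounded_weights_def)

lemma weights_pos: "w n > 0"
  using w unfolding bounded_weights_def by (meson less_le_trans)

lemma weights_nonzero [simp]: "w n \<noteq> 0"
  using weights_pos[of n] by simp

lemma gram_bounded_below: "\<exists>c>0. \<forall>n. c \<le> gram w n"
proof -
  obtain c where c: "c > 0" "\<And>n. c \<le> w n" using w by (auto simp: bounded_weights_def)
  then have sq: "c\<^sup>2 \<le> (w n)\<^sup>2" for n by (intro power_mono) auto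
  have "c\<^sup>2 \<le> gram w n" for n
    using sq[of 0] sq[of "Suc n"] by (cases n) (auto simp: gram_0 gram_Suc intro: add_increasing2)
  then show ?thesis using c(1) by (intro exI[of _ "c\<^sup>2"]) auto
qed

lemma gram_pos: "gram w n > 0"
  using gram_bounded_below by (meson less_le_trans)

lemma gram_nonzero [simp]: "gram w n \<noteq> 0"
  using gram_pos[of n] by simp

lemma bounded_inverse_gram: "bounded (range (\<lambda>n. 1 / gram w n))"
proof -
  obtain c where c: "c > 0" "\<And>n. c \<le> gram w n" using gram_bounded_below by blast
  then have "\<bar>1 / gram w n\<bar> \<le> 1 / c" for n
    using gram_pos[of n] by (simp add: frac_le)
  then show ?thesis by (auto simp: bounded_iff)
qed

lemma diag_op_gram_inverse:
  "diag_op (gram w) (diag_op (\<lambda>n. 1 / gram w n) f) = f"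
  "diag_op (\<lambda>n. 1 / gram w n) (diag_op (gram w) f) = f"
  by (auto intro!: ell2_eqI simp: nth_diag_op[OF bounded_gram[OF bounded_range_weights]]
      nth_diag_op[OF bounded_inverse_gram])

lemma left_invertible_wshift: "left_invertible (wshift w)"
  unfolding left_invertible_def
proof (intro exI conjI)
  let ?L = "\<lambda>f. diag_op (\<lambda>n. 1 / gram w n) (wshift_adj w f)"
  show "bounded_clinear ?L"
    using bounded_clinear_diag_op[OF bounded_inverse_gram] bounded_clinear_wshift_adj[OF bounded_range_weights]
    by (auto simp: bounded_clinear_def intro: bounded_linear_compose)
  show "?L \<circ> wshift w = id"
    by (auto simp: wshift_adj_wshift[OF bounded_range_weights] diag_op_gram_inverse)
qed

lemma bounded_weights_dual: "bounded_weights (dual_weights w)"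
proof -
  obtain C where C: "\<And>n. \<bar>w n\<bar> \<le> C" using bounded_range_weights by (auto simp: bounded_iff)
  obtain G where G: "\<And>n. \<bar>gram w n\<bar> \<le> G" using bounded_gram[OF bounded_range_weights] by (auto simp: bounded_iff)
  obtain c where c: "c > 0" "\<And>n. c \<le> w n" using w by (auto simp: bounded_weights_def)
  obtain d where d: "d > 0" "\<And>n. d \<le> gram w n" using gram_bounded_below by blast
  have G0: "G > 0" using G[of 0] gram_pos[of 0] by linarith
  have "\<bar>dual_weights w n\<bar> \<le> C / d" for n
    using C[of n] d gram_pos[of "n - 1"] unfolding dual_weights_def abs_divide by (intro frac_le) auto
  then have "bounded (range (dual_weights w))" by (auto simp: bounded_iff)
  moreover have "c / G \<le> dual_weights w n" for n
    unfolding dual_weights_def using c(2)[of n] G[of "n - 1"] gram_pos[of "n - 1"] weights_pos[of n]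
    by (intro frac_le) auto
  moreover have "c / G > 0" using c(1) G0 by simp
  ultimately show ?thesis
    unfolding bounded_weights_def by blast
qed

text \<open>For n = 0 the two weights share the divisor \<open>gram w 0\<close>; the weights that
  enter for later n are replaced by their reciprocals. This makes passing to the dual an
  involution.\<close>

lemma gram_dual: "gram (dual_weights w) n = 1 / gram w n"
proof (cases n)
  case 0
  have "gram (dual_weights w) 0 = gram w 0 / (gram w 0)\<^sup>2"
    by (simp add: gram_0[of "dual_weights w"] dual_weights_def power_divide
        flip: add_divide_distrib) (simp add: gram_0)
  then show ?thesis using 0 by (simp add: power2_eq_square)
qed (simp add: gram_Suc dual_weights_def power2_eq_square)

lemma dual_dual_weights: "dual_weights (dual_weights w) = w"
proof
  fix n
  have "dual_weights (dual_weights w) n = dual_weights w n * gram w (n - 1)"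
    by (simp add: dual_weights_def[of "dual_weights w"] gram_dual)
  then show "dual_weights (dual_weights w) n = w n" by (simp add: dual_weights_def)
qed

lemma wshift_dual: "wshift (dual_weights w) f = wshift w (diag_op (\<lambda>n. 1 / gram w n) f)"
proof (rule ell2_eqI)
  fix n
  show "nth_ell2 (wshift (dual_weights w) f) n =
      nth_ell2 (wshift w (diag_op (\<lambda>n. 1 / gram w n) f)) n"
    using bounded_weights_dual
    by (cases n) (simp_all add: bounded_weights_def bounded_range_weights nth_diag_op[OF bounded_inverse_gram]
        dual_weights_def)
qed

lemma cauchy_dual_wshift: "cauchy_dual (wshift w) = wshift (dual_weights w)"
proof -
  have "inv (adj (wshift w) \<circ> wshift w) = diag_op (\<lambda>n. 1 / gram w n)"
    by (rule inv_equality)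
      (simp_all add: adj_wshift[OF bounded_range_weights] wshift_adj_wshift[OF bounded_range_weights] diag_op_gram_inverse)
  then show ?thesis by (auto simp: cauchy_dual_def wshift_dual)
qed

lemma wshift_basis_0: "wshift w (basis_ell2 0) = w 0 *\<^sub>R basis_ell2 0 + w 1 *\<^sub>R basis_ell2 1"
  by (rule ell2_eqI) (auto simp: nth_wshift[OF bounded_range_weights])

lemma wshift_basis_Suc:
  "wshift w (basis_ell2 (Suc n)) = w (Suc (Suc n)) *\<^sub>R basis_ell2 (Suc (Suc n))"
  by (rule ell2_eqI) (auto simp: nth_wshift[OF bounded_range_weights])

lemma wshift_zero [simp]: "wshift w 0 = 0"
  by (rule ell2_eqI) (simp add: nth_wshift[OF bounded_range_weights])

lemma wshift_diff: "wshift w (f - g) = wshift w f - wshift w g"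
  by (rule ell2_eqI) (simp add: nth_wshift[OF bounded_range_weights] right_diff_distrib)

lemma wshift_adj_eq_0_cinner:
  assumes "wshift_adj w h = 0"
  shows "cinner (wshift w f) h = 0"
  using assms by (simp add: cinner_wshift[OF bounded_range_weights])

text \<open>Entry 0 of the Gram diagonal may be below 1; the vanishing coordinate 0 removes it from
  the sum.\<close>

lemma norm_wshift_ge:
  assumes "\<And>n. gram w (Suc n) \<ge> 1" and "nth_ell2 f 0 = 0"
  shows "norm f \<le> norm (wshift w f)"
proof -
  have "(cmod (nth_ell2 f n))\<^sup>2 \<le> gram w n * (cmod (nth_ell2 f n))\<^sup>2" for n
    using assms mult_right_mono[OF assms(1), of "(cmod (nth_ell2 f n))\<^sup>2" "n - 1"]
    by (cases n) auto
  then have "(norm f)\<^sup>2 \<le> (norm (wshift w f))\<^sup>2"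
    unfolding norm_wshift_square[OF bounded_range_weights] norm_ell2_square[of f]
    by (intro suminf_le summable_nth_ell2 summable_diag_form bounded_gram bounded_range_weights)
  then show ?thesis by (rule power2_le_imp_le) simp
qed

text \<open>Each later basis vector arises from its predecessor by applying the shift and rescaling,
  after removal of an \<open>e_0\<close> component in the first step.\<close>

lemma cyclic_vector_wshift: "cyclic_vector (wshift w) (basis_ell2 0)"
  unfolding cyclic_vector_def
proof (rule closure_cspan_eq_UNIV)
  let ?A = "{(wshift w ^^ n) (basis_ell2 0) |n. True}"
  have inv: "wshift w x \<in> cspan ?A" if "x \<in> cspan ?A" for x
  proof (rule cspan_invariant[OF bounded_clinear_wshift[OF bounded_range_weights] _ that])
    fix y assume "y \<in> ?A"
    then obtain n where "y = (wshift w ^^ n) (basis_ell2 0)" by blast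
    then have "wshift w y = (wshift w ^^ Suc n) (basis_ell2 0)" by simp
    then show "wshift w y \<in> cspan ?A" by (intro complex_vector.span_base) blast
  qed
  have "basis_ell2 0 = (wshift w ^^ 0) (basis_ell2 0)" by simp
  then have e0: "basis_ell2 0 \<in> cspan ?A"
    by (intro complex_vector.span_base) blast
  have "basis_ell2 n \<in> cspan ?A" for n
  proof (induction n)
    case (Suc n)
    have "basis_ell2 (Suc n) = complex_of_real (1 / w (Suc n)) *\<^sub>C
        (wshift w (basis_ell2 n) - complex_of_real (if n = 0 then w 0 else 0) *\<^sub>C basis_ell2 0)"
      by (rule ell2_eqI) (cases n; auto simp: nth_wshift[OF bounded_range_weights])
    also have "\<dots> \<in> cspan ?A"
      by (intro complex_vector.span_scale complex_vector.span_diff inv Suc e0)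
    finally show ?case .
  qed (rule e0)
  then show "basis_ell2 n \<in> closure (cspan ?A)" for n
    using closure_subset by blast
qed

text \<open>After n applications of the shift, coordinates 0 to n obey the recursion of
  \<open>eig_seq\<close> whatever the starting vector; membership in the k-th range settles
  coordinate k.\<close>

lemma nth_hyper_range:
  assumes "f \<in> hyper_range (wshift w)"
  shows "nth_ell2 f k = nth_ell2 f 0 * complex_of_real (eig_seq w k)"
proof -
  have "\<forall>k\<le>n. nth_ell2 ((wshift w ^^ n) g) k =
      nth_ell2 ((wshift w ^^ n) g) 0 * complex_of_real (eig_seq w k)" for n g
  proof (induction n)
    case (Suc n)
    show ?case
    proof (intro allI impI)
      fix k assume "k \<le> Suc n"
      then show "nth_ell2 ((wshift w ^^ Suc n) g) k =
          nth_ell2 ((wshift w ^^ Suc n) g) 0 * complex_of_real (eig_seq w k)"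
        using Suc[rule_format, of "k - 1"] by (cases k) (auto simp: bounded_range_weights)
    qed
  qed simp
  moreover obtain g where "f = (wshift w ^^ k) g"
    using assms by (auto simp: hyper_range_on_def)
  ultimately show ?thesis by blast
qed

lemma funpow_wshift_zero: "(wshift w ^^ n) 0 = 0"
  by (induction n) auto

lemma analytic_wshift:
  assumes "\<not> summable (\<lambda>n. (eig_seq w n)\<^sup>2)"
  shows "analytic_op (wshift w)"
proof -
  have "f = 0" if f: "f \<in> hyper_range (wshift w)" for f
  proof -
    have eq: "nth_ell2 f k = nth_ell2 f 0 * complex_of_real (eig_seq w k)" for k
      by (rule nth_hyper_range[OF f])
    have "nth_ell2 f 0 = 0"
    proof (rule ccontr)
      assume nz: "nth_ell2 f 0 \<noteq> 0"
      have "(cmod (nth_ell2 f k))\<^sup>2 = (cmod (nth_ell2 f 0))\<^sup>2 * (eig_seq w k)\<^sup>2" for k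
        by (subst eq) (simp add: norm_mult power_mult_distrib)
      then have "summable (\<lambda>k. (cmod (nth_ell2 f k))\<^sup>2) \<longleftrightarrow>
          summable (\<lambda>n. (cmod (nth_ell2 f 0))\<^sup>2 * (eig_seq w n)\<^sup>2)"
        by (rule summable_cong[OF always_eventually, OF allI])
      then have "summable (\<lambda>n. (cmod (nth_ell2 f 0))\<^sup>2 * (eig_seq w n)\<^sup>2)"
        by (simp only: summable_nth_ell2)
      then show False using assms nz by (simp add: summable_cmult_iff)
    qed
    then have "nth_ell2 f k = nth_ell2 0 k" for k using eq[of k] by simp
    then show "f = 0" by (rule ell2_eqI)
  qed
  moreover have "0 \<in> hyper_range (wshift w)"
    unfolding hyper_range_on_def by (auto intro!: image_eqI[of 0 _ 0] simp: funpow_wshift_zero)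
  ultimately show ?thesis unfolding analytic_op_on_def by blast
qed

context
  assumes sm: "summable (\<lambda>n. (eig_seq w n)\<^sup>2)"
begin

lemma nth_eig_vec: "nth_ell2 (eig_vec w) n = complex_of_real (eig_seq w n)"
  unfolding eig_vec_def by (subst nth_Abs_ell2) (use sm in simp_all)

lemma wshift_eig_vec: "wshift w (eig_vec w) = complex_of_real (w 0) *\<^sub>C eig_vec w"
proof (rule ell2_eqI)
  fix n
  show "nth_ell2 (wshift w (eig_vec w)) n = nth_ell2 (complex_of_real (w 0) *\<^sub>C eig_vec w) n"
    by (cases n) (simp_all add: bounded_range_weights nth_eig_vec)
qed

lemma hyper_range_wshift:
  "hyper_range (wshift w) = {c *\<^sub>C eig_vec w | c. True}"
proof (intro subset_antisym subsetI)
  fix f assume f: "f \<in> hyper_range (wshift w)"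
  have "f = nth_ell2 f 0 *\<^sub>C eig_vec w"
  proof (rule ell2_eqI)
    show "nth_ell2 f k = nth_ell2 (nth_ell2 f 0 *\<^sub>C eig_vec w) k" for k
      using nth_hyper_range[OF f, of k] by (simp add: nth_eig_vec)
  qed
  then show "f \<in> {c *\<^sub>C eig_vec w | c. True}" by blast
next
  fix f assume "f \<in> {c *\<^sub>C eig_vec w | c. True}"
  then obtain c where f: "f = c *\<^sub>C eig_vec w" by blast
  have pow: "(wshift w ^^ n) (d *\<^sub>C eig_vec w) = (d * complex_of_real (w 0) ^ n) *\<^sub>C eig_vec w" for n d
    by (induction n) (simp_all add: wshift_scaleC[OF bounded_range_weights] wshift_eig_vec scaleC_scaleC mult_ac)
  have "f = (wshift w ^^ n) ((c / complex_of_real (w 0) ^ n) *\<^sub>C eig_vec w)" for n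
    unfolding pow f by simp
  then show "f \<in> hyper_range (wshift w)" unfolding hyper_range_on_def by blast
qed

text \<open>The eigenvector spans the hyper-range, but its orthogonal complement is not invariant because
  \<^term>\<open>w 1 \<noteq> 0\<close>.\<close>

lemma not_wold_type_wshift: "\<not> wold_type_decomposition (wshift w)"
proof
  let ?v = "eig_vec w"
  assume "wold_type_decomposition (wshift w)"
  then obtain Hu Ha where os: "orthogonal_sum Hu Ha" and Ha: "wshift w ` Ha \<subseteq> Ha"
    and "Hu = hyper_range (wshift w)"
    unfolding wold_type_decomposition_def by blast
  then have Hu: "Hu = {c *\<^sub>C ?v | c. True}" using hyper_range_wshift by simp
  obtain x y where "x \<in> Hu" and y: "y \<in> Ha" and xy: "basis_ell2 0 = x + y"
    using os unfolding orthogonal_sum_def by blast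
  then obtain c where x: "x = c *\<^sub>C ?v" unfolding Hu by blast
  have "?v = 1 *\<^sub>C ?v" by (simp add: scaleC_one)
  then have "?v \<in> Hu" unfolding Hu by blast
  then have orth: "cinner z ?v = 0" if "z \<in> Ha" for z
    using os that unfolding orthogonal_sum_def by (metis cinner_commute complex_cnj_zero)
  have "cinner (basis_ell2 0) ?v = 1" by (simp add: cinner_basis_left nth_eig_vec)
  then have c: "c * cinner ?v ?v = 1"
    unfolding xy x cinner_add_left cinner_scaleC_left orth[OF y] by simp
  \<comment> \<open>The same inner product is computed twice. Invariance of \<open>Ha\<close>
    removes the \<open>y\<close> part and leaves \<open>w 0\<close>; passing to the adjoint gives an
    additional nonzero term, the square of \<open>w 1\<close> divided by \<open>w 0\<close>.\<close>
  have "cinner (wshift w (basis_ell2 0)) ?v = complex_of_real (w 0) * (c * cinner ?v ?v)"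
    using orth[of "wshift w y"] Ha y
    by (auto simp: xy x wshift_add[OF bounded_range_weights] wshift_scaleC[OF bounded_range_weights] wshift_eig_vec cinner_add_left
        cinner_scaleC_left)
  moreover have "cinner (wshift w (basis_ell2 0)) ?v =
      complex_of_real (w 0 + w (Suc 0) * (w (Suc 0) / w 0))"
    by (simp add: cinner_wshift[OF bounded_range_weights] cinner_basis_left nth_eig_vec bounded_range_weights)
  ultimately have "w 0 + w (Suc 0) * (w (Suc 0) / w 0) = w 0"
    unfolding c by (metis mult.right_neutral of_real_eq_iff)
  then show False by simp
qed

end

end

section \<open>The wandering subspace property\<close>

context
  fixes w :: "nat \<Rightarrow> real"
  assumes w: "bounded_weights w"
begin

lemma wandering_property_wshift_iff:
  "wandering_property (wshift w) \<longleftrightarrow>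
    closure (cspan {(wshift w ^^ n) h | n h. wshift_adj w h = 0}) = UNIV"
  by (simp add: wandering_property_on_def adj_wshift[OF bounded_range_weights[OF w]])

text \<open>Modulo the span of the vectors \<open>T\<^sup>n h\<close> with \<open>h\<close> in the kernel of the adjoint,
  each \<open>e\<^sub>n\<close> equals \<open>v\<^sub>n e\<^sub>0\<close>, where \<open>v\<close> is the eigensequence of the dual weights. If \<open>v\<close> is
  unbounded, then \<open>e\<^sub>0\<close> is a limit of the vectors \<open>e\<^sub>0 - e\<^sub>n / v\<^sub>n\<close> of that span.\<close>

lemma wandering_property_wshift:
  assumes unbounded: "\<not> bounded (range (eig_seq (dual_weights w)))"
  shows "wandering_property (wshift w)"
  unfolding wandering_property_wshift_iff
proof (rule closure_cspan_eq_UNIV)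
  note bw = bounded_range_weights[OF w] and nz = weights_nonzero[OF w] gram_nonzero[OF w]
  define v where "v = eig_seq (dual_weights w)"
  let ?A = "{(wshift w ^^ n) h | n h. wshift_adj w h = 0}"
  have inv: "wshift w x \<in> cspan ?A" if "x \<in> cspan ?A" for x
  proof (rule cspan_invariant[OF bounded_clinear_wshift[OF bw] _ that])
    fix y assume "y \<in> ?A"
    then obtain n h where y: "y = (wshift w ^^ n) h" and h: "wshift_adj w h = 0" by blast
    have "wshift w y = (wshift w ^^ Suc n) h" using y by simp
    then show "wshift w y \<in> cspan ?A" using h by (intro complex_vector.span_base) blast
  qed
  \<comment> \<open>This vector spans the kernel of the adjoint. It yields the case of
    \<open>e_1\<close> directly, and later absorbs the \<open>e_1\<close> component that the shift
    creates from \<open>e_0\<close>.\<close>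
  define h where "h = complex_of_real (w 1) *\<^sub>C basis_ell2 0 - complex_of_real (w 0) *\<^sub>C basis_ell2 1"
  have "wshift_adj w h = 0"
    by (rule ell2_eqI) (auto simp: h_def nth_wshift_adj[OF bw])
  moreover have "h = (wshift w ^^ 0) h" by simp
  ultimately have h: "h \<in> cspan ?A" by (intro complex_vector.span_base) blast
  have v_0: "v 0 = 1" by (simp add: v_def)
  have v_Suc: "v (Suc n) = w (Suc n) / gram w n * (gram w 0 / w 0) * v n" for n
    by (simp add: v_def dual_weights_def)
  have N: "basis_ell2 n - complex_of_real (v n) *\<^sub>C basis_ell2 0 \<in> cspan ?A" for n
  proof (induction n)
    case 0
    show ?case by (simp add: v_0 scaleC_one complex_vector.span_zero)
  next
    case (Suc n)
    let ?x = "basis_ell2 n - complex_of_real (v n) *\<^sub>C basis_ell2 0"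
    show ?case
    proof (cases n)
      case 0
      have "basis_ell2 (Suc n) - complex_of_real (v (Suc n)) *\<^sub>C basis_ell2 0
          = complex_of_real (- 1 / w 0) *\<^sub>C h"
        unfolding 0 v_Suc v_0 h_def by (rule ell2_eqI) (auto simp: nz)
      then show ?thesis using h by (simp only: complex_vector.span_scale)
    next
      case (Suc m)
      have v2: "v (Suc (Suc m)) = gram w 0 / (w 0 * w (Suc (Suc m))) * v (Suc m)"
        using v_Suc[of n] by (simp add: Suc gram_Suc power2_eq_square nz)
      \<comment> \<open>The chosen multiple of \<open>h\<close> cancels \<open>e_1\<close>. Before
        rescaling, the coefficient of \<open>e_0\<close> becomes
        \<open>- v n * gram w 0 / w 0\<close>, in accordance with \<open>v2\<close>.\<close>
      have "basis_ell2 (Suc n) - complex_of_real (v (Suc n)) *\<^sub>C basis_ell2 0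
          = complex_of_real (1 / w (Suc n)) *\<^sub>C
            (wshift w ?x - complex_of_real (v n * w 1 / w 0) *\<^sub>C h)"
        unfolding v2 wshift_diff[OF w] wshift_scaleC[OF bw] wshift_basis_0[OF w]
          wshift_basis_Suc[OF w] Suc h_def gram_0
        by (rule ell2_eqI) (auto simp: nz field_simps power2_eq_square)
      also have "\<dots> \<in> cspan ?A"
        by (intro complex_vector.span_scale complex_vector.span_diff inv Suc.IH h)
      finally show ?thesis .
    qed
  qed
  have "basis_ell2 0 \<in> closure (cspan ?A)"
    unfolding closure_approachable
  proof (intro allI impI)
    fix e :: real assume e: "e > 0"
    obtain n where n: "\<bar>v n\<bar> > 1 / e"
      using unbounded unfolding v_def[symmetric] bounded_iff by (auto simp: not_le)
    then have vn: "v n \<noteq> 0" using e by auto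
    let ?y = "complex_of_real (- 1 / v n) *\<^sub>C (basis_ell2 n - complex_of_real (v n) *\<^sub>C basis_ell2 0)"
    have "?y - basis_ell2 0 = complex_of_real (- 1 / v n) *\<^sub>C basis_ell2 n"
      by (rule ell2_eqI) (simp add: vn field_simps)
    then have "dist ?y (basis_ell2 0) = 1 / \<bar>v n\<bar>"
      by (simp add: dist_norm norm_scaleC norm_basis_ell2 norm_divide)
    also have "\<dots> < e" using n e vn by (simp add: field_simps)
    finally show "\<exists>y\<in>cspan ?A. dist y (basis_ell2 0) < e"
      using complex_vector.span_scale[OF N] by blast
  qed
  note e0 = this
  show "basis_ell2 n \<in> closure (cspan ?A)" for n
  proof -
    have "basis_ell2 n = (basis_ell2 n - complex_of_real (v n) *\<^sub>C basis_ell2 0)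
        + complex_of_real (v n) *\<^sub>C basis_ell2 0" by simp
    also have "\<dots> \<in> closure (cspan ?A)"
      using N[of n] e0 closure_subset csubspace_closure[OF complex_vector.subspace_span]
      by (blast intro: complex_vector.subspace_add complex_vector.subspace_scale)
    finally show ?thesis .
  qed
qed

text \<open>An eigenvector \<open>g\<close> of the Cauchy dual lies in the range of the shift, hence
  is orthogonal to the kernel of the adjoint. It is also an eigenvector of the adjoint, with the
  reciprocal eigenvalue, so orthogonality extends to all images of that kernel under powers of the
  shift. But \<open>e_0\<close> is not orthogonal to \<open>g\<close>.\<close>

lemma not_wandering_property_wshift:
  assumes sm: "summable (\<lambda>n. (eig_seq (dual_weights w) n)\<^sup>2)"
  shows "\<not> wandering_property (wshift w)"
proof -
  note bw = bounded_range_weights[OF w] and dual = bounded_weights_dual[OF w]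
  define g where "g = eig_vec (dual_weights w)"
  define u where "u = dual_weights w 0"
  have u: "u \<noteq> 0" unfolding u_def by (rule weights_nonzero[OF dual])
  have "wshift w (diag_op (\<lambda>n. 1 / gram w n) g) = complex_of_real u *\<^sub>C g"
    using wshift_eig_vec[OF dual sm] by (simp add: wshift_dual[OF w] g_def u_def)
  then have ug: "g = wshift w (complex_of_real (1 / u) *\<^sub>C diag_op (\<lambda>n. 1 / gram w n) g)"
    using u by (simp add: wshift_scaleC[OF bw] scaleC_scaleC scaleC_one)
  have "wshift_adj w g = complex_of_real (1 / u) *\<^sub>C g"
    by (subst ug) (simp add: wshift_scaleC[OF bw] wshift_adj_scaleC[OF bw]
        wshift_adj_wshift[OF bw] diag_op_gram_inverse[OF w])
  then have eig: "cinner (wshift w x) g = complex_of_real (1 / u) * cinner x g" for x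
    by (simp add: cinner_wshift[OF bw] cinner_scaleC_right)
  have "cinner ((wshift w ^^ n) h) g = 0" if "wshift_adj w h = 0" for n h
  proof (induction n)
    case 0
    have "cinner h g = cnj (cinner g h)" by (rule cinner_commute)
    also have "cinner g h = 0" by (subst ug) (rule wshift_adj_eq_0_cinner[OF w that])
    finally show ?case by simp
  qed (simp add: eig)
  then have "cspan {(wshift w ^^ n) h | n h. wshift_adj w h = 0} \<subseteq> {x. cinner x g = 0}"
    by (intro complex_vector.span_minimal csubspace_orthogonal) blast
  then have "closure (cspan {(wshift w ^^ n) h | n h. wshift_adj w h = 0}) \<subseteq> {x. cinner x g = 0}"
    by (rule closure_minimal) (rule closed_orthogonal)
  moreover have "cinner (basis_ell2 0) g = 1"
    by (simp add: cinner_basis_left g_def nth_eig_vec[OF dual sm])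
  then have "basis_ell2 0 \<notin> {x. cinner x g = 0}" by simp
  ultimately show ?thesis unfolding wandering_property_wshift_iff by blast
qed

text \<open>Analyticity forces the unitary summand to be zero, and the whole space serves as the
  analytic one.\<close>

lemma wold_type_wshift:
  assumes "analytic_op (wshift w)" and "wandering_property (wshift w)"
  shows "wold_type_decomposition (wshift w)"
proof -
  have sub0: "csubspace {0 :: ell2}" and subU: "csubspace (UNIV :: ell2 set)"
    by (auto simp: complex_vector.subspace_def)
  have "adj_on {0} (wshift w) 0 = 0"
    by (rule adj_on_eqI[OF sub0]) auto
  then have "unitary_on {0} (wshift w)"
    by (simp add: unitary_on_def wshift_zero[OF w])
  moreover have "orthogonal_sum {0 :: ell2} UNIV"
    using sub0 subU by (simp add: orthogonal_sum_def)
  moreover have "wshift w ` {0} \<subseteq> {0}" by (simp add: wshift_zero[OF w])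
  ultimately have "\<exists>Ha. orthogonal_sum {0} Ha \<and> wshift w ` {0} \<subseteq> {0} \<and> wshift w ` Ha \<subseteq> Ha \<and>
      {0} = hyper_range (wshift w) \<and> unitary_on {0} (wshift w) \<and>
      analytic_op_on Ha (wshift w) \<and> wandering_property_on Ha (wshift w)"
    using assms unfolding analytic_op_on_def by (intro exI[of _ UNIV]) (simp only: subset_UNIV simp_thms)
  then show ?thesis
    using left_invertible_wshift[OF w] bounded_clinear_wshift[OF bounded_range_weights[OF w]]
    unfolding wold_type_decomposition_def by blast
qed

lemma norm_wshift_basis_0: "(norm (wshift w (basis_ell2 0)))\<^sup>2 = gram w 0"
proof -
  have "(\<Sum>n. gram w n * (cmod (nth_ell2 (basis_ell2 0) n))\<^sup>2) = gram w 0"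
    by (subst suminf_finite[of "{0}"]) auto
  then show ?thesis by (simp only: norm_wshift_square[OF bounded_range_weights[OF w]])
qed

end

text \<open>Used in contrapositive form: unboundedness, as in
  \<open>wandering_property_wshift\<close>, also yields the non-summability that
  \<open>analytic_wshift\<close> asks for.\<close>

lemma summable_square_imp_bounded:
  fixes f :: "nat \<Rightarrow> real"
  assumes "summable (\<lambda>n. (f n)\<^sup>2)"
  shows "bounded (range f)"
proof -
  have "(\<lambda>n. sqrt ((f n)\<^sup>2)) \<longlonglongrightarrow> sqrt 0"
    by (intro tendsto_real_sqrt summable_LIMSEQ_zero assms)
  then have "f \<longlonglongrightarrow> 0" by (simp add: tendsto_rabs_zero_iff)
  then show ?thesis by (intro convergent_imp_bounded) (auto simp: convergent_def)
qed

section \<open>The weights of the theorem\<close>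

lemma S_eps_eq_wshift: "S_eps a b \<epsilon> = wshift (weight a b \<epsilon>)"
  by (simp add: fun_eq_iff S_eps_def wshift_def)

section \<open>Growth of the polynomial p\<close>

context
  fixes a b :: real
  assumes a: "a > 0" and b: "b > 0"
begin

text \<open>Serves to bound the weights from above. The increment is
  \<open>a + b + 2 * b * n\<close>; here \<open>2 * b * n\<close> is at most twice the value at n
  because n is at most its square, and \<open>a + b\<close> is absorbed because that value is at
  least 1.\<close>

lemma p_poly_Suc_le:
  "p_poly a b (Suc n) \<le> (3 + a + b) * p_poly a b n"
proof -
  have "real n \<le> (real n)\<^sup>2" by (cases n) (auto simp: power2_eq_square)
  then have "b * real n \<le> b * (real n)\<^sup>2" using a b by simp
  moreover have "0 \<le> a * real n" "0 \<le> b * (real n)\<^sup>2" using a b by simp_all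
  ultimately have "2 * b * real n \<le> 2 * p_poly a b n" and "1 \<le> p_poly a b n"
    by (simp_all add: p_poly_def)
  moreover from this(2) have "a + b \<le> (a + b) * p_poly a b n" using a b by simp
  moreover have "p_poly a b (Suc n) = p_poly a b n + (a + b) + 2 * b * real n"
    by (simp add: p_poly_def power2_eq_square algebra_simps)
  ultimately show ?thesis by (simp add: algebra_simps)
qed

lemma p_poly_pos: "p_poly a b n > 0"
  using a b by (auto simp: p_poly_def intro!: add_pos_nonneg)

lemma p_poly_nonzero [simp]: "p_poly a b n \<noteq> 0"
  using p_poly_pos[of n] by simp

lemma one_le_p_poly_ratio: "1 \<le> p_poly a b (Suc n) / p_poly a b n"
proof -
  have "p_poly a b n \<le> p_poly a b (Suc n)"
    unfolding p_poly_def using a b by (intro add_mono mult_left_mono power_mono) auto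
  then show ?thesis using p_poly_pos[of n] by simp
qed

lemma summable_inverse_p_poly:
  "summable (\<lambda>n. 1 / p_poly a b n)"
proof (rule summable_comparison_test')
  show "summable (\<lambda>n. 1 / b * inverse (real n ^ 2))"
    by (intro summable_mult inverse_power_summable) simp
  fix n :: nat assume "n \<ge> 1"
  then have "0 < b * (real n)\<^sup>2" "b * (real n)\<^sup>2 \<le> p_poly a b n"
    using b a by (simp_all add: p_poly_def)
  then have "1 / p_poly a b n \<le> 1 / (b * (real n)\<^sup>2)" and "0 < p_poly a b n"
    by (simp_all add: frac_le)
  then show "norm (1 / p_poly a b n) \<le> 1 / b * inverse (real n ^ 2)"
    by (simp add: field_simps)
qed

lemma not_bounded_power_over_sqrt_p_poly:
  fixes r :: real
  assumes "r > 1" "c > 0"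
  shows "\<not> bounded (range (\<lambda>n. c * r ^ n / sqrt (p_poly a b n)))"
proof
  assume "bounded (range (\<lambda>n. c * r ^ n / sqrt (p_poly a b n)))"
  then obtain B where B: "\<And>n. \<bar>c * r ^ n / sqrt (p_poly a b n)\<bar> \<le> B" by (auto simp: bounded_iff)
  have "filterlim (\<lambda>n. c * r ^ n / sqrt (p_poly a b n)) at_top sequentially"
    using a b assms unfolding p_poly_def by real_asymp
  then have "eventually (\<lambda>n. c * r ^ n / sqrt (p_poly a b n) > B) sequentially"
    by (simp add: filterlim_at_top_dense)
  then obtain n where "c * r ^ n / sqrt (p_poly a b n) > B"
    using eventually_happens by force
  then show False using B[of n] by linarith
qed

lemma admissible_exists:
  "\<exists>\<epsilon>0. admissible a b \<epsilon>0"
proof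
  \<comment> \<open>The bound \<open>b / (a + b)\<close> yields
    \<open>b / \<epsilon> > a + b\<close>, which suffices because the left side of the goal contains
    \<open>2 * (b / \<epsilon>) - b\<close>. The bound 1/2 keeps \<open>\<epsilon>0\<close> below
    1.\<close>
  define \<epsilon>0 where "\<epsilon>0 = min (1 / 2) (b / (a + b))"
  have "\<epsilon> + b * (2 / \<epsilon> - 1) > a" if "0 < \<epsilon>" "\<epsilon> < \<epsilon>0" for \<epsilon>
  proof -
    have "\<epsilon> < b / (a + b)" using that by (simp add: \<epsilon>0_def)
    then have "a + b < b / \<epsilon>" using that a b by (simp add: field_simps)
    moreover have "b * (2 / \<epsilon> - 1) = 2 * (b / \<epsilon>) - b" by (simp add: right_diff_distrib)
    ultimately show ?thesis using that a b by linarith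
  qed
  then show "admissible a b \<epsilon>0" using a b by (auto simp: admissible_def \<epsilon>0_def)
qed

section \<open>The operator for a fixed \<epsilon>\<close>

context
  fixes \<epsilon> :: real
  assumes \<epsilon>: "0 < \<epsilon>" "\<epsilon> < 1" and K: "K_eps a b \<epsilon> > 0"
begin

lemma weight_0_square: "(weight a b \<epsilon> 0)\<^sup>2 = 1 - \<epsilon>"
  using \<epsilon> by (simp add: weight_def)

lemma weight_1_square: "(weight a b \<epsilon> (Suc 0))\<^sup>2 = \<epsilon> ^ 3 / K_eps a b \<epsilon>"
  using \<epsilon> K by (simp add: weight_def)

lemma weight_Suc_Suc: "weight a b \<epsilon> (Suc (Suc n)) = sqrt (p_poly a b (Suc n) / p_poly a b n)"
  by (simp add: weight_def)

lemma weight_Suc_Suc_square: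
  "(weight a b \<epsilon> (Suc (Suc n)))\<^sup>2 = p_poly a b (Suc n) / p_poly a b n"
  using p_poly_pos[of n] p_poly_pos[of "Suc n"] by (simp add: weight_Suc_Suc)

lemma bounded_weights_weight: "bounded_weights (weight a b \<epsilon>)"
proof -
  let ?w = "weight a b \<epsilon>"
  have w0: "?w 0 > 0" and w1: "?w (Suc 0) > 0"
    using \<epsilon> K by (simp_all add: weight_def)
  have w2: "1 \<le> ?w (Suc (Suc n))" "?w (Suc (Suc n)) \<le> sqrt (3 + a + b)" for n
    using one_le_p_poly_ratio[of n] p_poly_Suc_le[of n] p_poly_pos[of n]
    by (auto simp: weight_Suc_Suc pos_divide_le_eq)
  define C where "C = max (?w 0) (max (?w (Suc 0)) (sqrt (3 + a + b)))"
  define c where "c = min (?w 0) (min (?w (Suc 0)) 1)"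
  have c: "c \<le> ?w n" and C: "?w n \<le> C" for n
    using w2[of "n - 2"] by (cases n; cases "n - 1"; force simp: c_def C_def)+
  have c0: "c > 0" using w0 w1 by (simp add: c_def)
  have "\<bar>?w n\<bar> \<le> C" for n
    using c0 c[of n] C[of n] by simp
  then show ?thesis
    unfolding bounded_weights_def bounded_iff using c0 c by auto
qed

lemma gram_weight_0: "gram (weight a b \<epsilon>) 0 = 1 - \<epsilon> + \<epsilon> ^ 3 / K_eps a b \<epsilon>"
  by (simp add: gram_0 weight_0_square weight_1_square)

lemma gram_weight_Suc: "gram (weight a b \<epsilon>) (Suc n) = p_poly a b (Suc n) / p_poly a b n"
  by (simp add: gram_Suc weight_Suc_Suc_square)

text \<open>The squared weights are successive ratios of p, so their product telescopes.\<close>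

lemma conj_diag_weight_pow_Suc:
  "(conj_diag (weight a b \<epsilon>) ^^ k) (\<lambda>_. 1) (Suc n) = p_poly a b (n + k) / p_poly a b n"
proof (induction k arbitrary: n)
  case (Suc k)
  then show ?case
    by (simp add: conj_diag_def[of _ _ "Suc n"] weight_Suc_Suc_square)
qed simp

text \<open>Coordinate 0 receives the previous entries at 0 and at 1. The latter is
  \<open>p_poly a b k\<close>, since p takes the value 1 at 0.\<close>

lemma conj_diag_weight_pow_0:
  "(conj_diag (weight a b \<epsilon>) ^^ Suc k) (\<lambda>_. 1) 0 =
    (1 - \<epsilon>) * (conj_diag (weight a b \<epsilon>) ^^ k) (\<lambda>_. 1) 0 + \<epsilon> ^ 3 / K_eps a b \<epsilon> * p_poly a b k"
  using conj_diag_weight_pow_Suc[of k 0]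
  by (simp add: conj_diag_def[of _ _ 0] weight_0_square weight_1_square p_poly_def[of a b 0])

lemma three_isometry_weight: "three_isometry (wshift (weight a b \<epsilon>))"
proof (rule three_isometry_wshift[OF bounded_range_weights[OF bounded_weights_weight]])
  fix n
  define D where "D k = (conj_diag (weight a b \<epsilon>) ^^ k) (\<lambda>_. 1) n" for k
  have "D 0 - 3 * D 1 + 3 * D 2 - D 3 = 0"
  proof (cases n)
    case 0
    define s where "s = \<epsilon> ^ 3 / K_eps a b \<epsilon>"
    have sK: "s * (\<epsilon>\<^sup>2 - \<epsilon> * (a + b) + 2 * b) = \<epsilon> ^ 3"
      using K by (simp add: s_def K_eps_def)
    have Suc: "D (Suc k) = (1 - \<epsilon>) * D k + s * (1 + a * k + b * k\<^sup>2)" for k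
      unfolding D_def 0 conj_diag_weight_pow_0 by (simp add: s_def p_poly_def)
    have D: "D 0 = 1" "D 1 = 1 - \<epsilon> + s" "D 2 = (1 - \<epsilon>) * D 1 + s * (1 + a + b)"
      "D 3 = (1 - \<epsilon>) * D 2 + s * (1 + 2 * a + 4 * b)"
      using Suc[of 0] Suc[of 1] Suc[of 2] by (simp_all add: D_def numeral_2_eq_2 numeral_3_eq_3)
    \<comment> \<open>The weight with index 1 is tuned for this cancellation: the alternating sum is
      \<epsilon>^3 minus \<open>s\<close> times \<open>K_eps a b \<epsilon>\<close>, which is zero
      by \<open>sK\<close>.\<close>
    have "D 0 - 3 * D 1 + 3 * D 2 - D 3 = s * (\<epsilon>\<^sup>2 - \<epsilon> * (a + b) + 2 * b) * - 1 + \<epsilon> ^ 3"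
      unfolding D by algebra
    then show ?thesis using sK by simp
  next
    case (Suc m)
    have D: "D k = p_poly a b (m + k) / p_poly a b m" for k
      unfolding D_def Suc conj_diag_weight_pow_Suc ..
    \<comment> \<open>The third difference of a quadratic polynomial vanishes.\<close>
    have "p_poly a b m - 3 * p_poly a b (m + 1) + 3 * p_poly a b (m + 2) - p_poly a b (m + 3) = 0"
      by (simp add: p_poly_def power2_eq_square algebra_simps)
    then have "(p_poly a b m - 3 * p_poly a b (m + 1) + 3 * p_poly a b (m + 2) - p_poly a b (m + 3))
        / p_poly a b m = 0" by simp
    then show ?thesis unfolding D by (simp add: diff_divide_distrib add_divide_distrib)
  qed
  then show "(\<Sum>k\<le>3. (- 1) ^ k * real (3 choose k) * (conj_diag (weight a b \<epsilon>) ^^ k) (\<lambda>_. 1) n) = 0"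
    unfolding D_def[symmetric] by (simp add: eval_nat_numeral)
qed

lemma eig_seq_weight_square:
  "(eig_seq (weight a b \<epsilon>) (Suc n))\<^sup>2 = \<epsilon> ^ 3 / K_eps a b \<epsilon> * p_poly a b n / (1 - \<epsilon>) ^ Suc n"
proof (induction n)
  case 0
  show ?case by (simp add: power_divide weight_0_square weight_1_square p_poly_def)
next
  case (Suc n)
  have "(eig_seq (weight a b \<epsilon>) (Suc (Suc n)))\<^sup>2 =
      (weight a b \<epsilon> (Suc (Suc n)))\<^sup>2 / (weight a b \<epsilon> 0)\<^sup>2 * (eig_seq (weight a b \<epsilon>) (Suc n))\<^sup>2"
    unfolding eig_seq.simps(2)[of _ "Suc n"] power_mult_distrib power_divide ..
  then show ?case
    unfolding Suc weight_Suc_Suc_square weight_0_square by (simp add: mult_ac)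
qed

text \<open>Linear growth of the squares is enough: p is at least \<open>a * n\<close>, and dividing
  by a power of \<open>1 - \<epsilon>\<close> only enlarges the value.\<close>

lemma not_bounded_eig_seq_weight: "\<not> bounded (range (eig_seq (weight a b \<epsilon>)))"
proof
  assume "bounded (range (eig_seq (weight a b \<epsilon>)))"
  then obtain C where C: "\<And>n. \<bar>eig_seq (weight a b \<epsilon>) n\<bar> \<le> C" by (auto simp: bounded_iff)
  define s where "s = \<epsilon> ^ 3 / K_eps a b \<epsilon>"
  have s: "s > 0" using \<epsilon> K by (simp add: s_def)
  obtain n where n: "real n > C\<^sup>2 / (s * a)" using reals_Archimedean2 by blast
  have "C\<^sup>2 < s * (a * real n)" using n s a by (simp add: pos_divide_less_eq mult_ac)
  also have "\<dots> \<le> s * p_poly a b n" using s b by (simp add: p_poly_def)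
  also have "\<dots> \<le> s * p_poly a b n / (1 - \<epsilon>) ^ Suc n"
  proof -
    have "(1 - \<epsilon>) ^ Suc n \<le> 1" "(1 - \<epsilon>) ^ Suc n > 0"
      using \<epsilon> by (intro power_le_one zero_less_power; simp)+
    then show ?thesis using s p_poly_pos[of n] by (simp add: pos_le_divide_eq mult_left_le)
  qed
  also have "\<dots> = \<bar>eig_seq (weight a b \<epsilon>) (Suc n)\<bar>\<^sup>2"
    unfolding power2_abs eig_seq_weight_square s_def ..
  also have "\<dots> \<le> C\<^sup>2" using C[of "Suc n"] by (intro power_mono) auto
  finally show False by simp
qed

text \<open>From index 2 on the dual weights are reciprocals of the original ones, so the square
  roots of p telescope into the denominator. Each such step also divides by the dual weight at 0,
  whose reciprocal is the ratio raised to the power n. In the first step the common divisor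
  \<open>gram\<close> at 0 cancels.\<close>

lemma eig_seq_dual_weight:
  "eig_seq (dual_weights (weight a b \<epsilon>)) (Suc n) =
    weight a b \<epsilon> 1 / weight a b \<epsilon> 0 * ((1 - \<epsilon> + \<epsilon> ^ 3 / K_eps a b \<epsilon>) / sqrt (1 - \<epsilon>)) ^ n / sqrt (p_poly a b n)"
proof (induction n)
  case 0
  have "gram (weight a b \<epsilon>) 0 \<noteq> 0" by (rule gram_nonzero[OF bounded_weights_weight])
  then show ?case by (simp add: dual_weights_def p_poly_def)
next
  case (Suc n)
  have p: "p_poly a b n > 0" "p_poly a b (Suc n) > 0" by (rule p_poly_pos)+
  have "dual_weights (weight a b \<epsilon>) (Suc (Suc n)) = sqrt (p_poly a b n) / sqrt (p_poly a b (Suc n))"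
    using p real_div_sqrt[of "p_poly a b n"] real_div_sqrt[of "p_poly a b (Suc n)"]
    by (simp add: dual_weights_def gram_weight_Suc weight_Suc_Suc real_sqrt_divide field_simps)
  moreover have "dual_weights (weight a b \<epsilon>) 0 = sqrt (1 - \<epsilon>) / (1 - \<epsilon> + \<epsilon> ^ 3 / K_eps a b \<epsilon>)"
    by (simp add: dual_weights_def gram_weight_0 weight_def)
  ultimately show ?case
    unfolding eig_seq.simps(2)[of _ "Suc n"] Suc using p by (simp add: mult_ac)
qed

text \<open>With t the square root of \<open>1 - \<epsilon>\<close>, both sides say that
  \<open>t * (1 - t)\<close> is less than
  \<open>\<epsilon> ^ 3 / K_eps a b \<epsilon>\<close>.\<close>

lemma wandering_ratio_iff:
  "K_eps a b \<epsilon> < wandering_bound \<epsilon> \<longleftrightarrow>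
    1 < (1 - \<epsilon> + \<epsilon> ^ 3 / K_eps a b \<epsilon>) / sqrt (1 - \<epsilon>)"
proof -
  define t where "t = sqrt (1 - \<epsilon>)"
  have t: "0 < t" "t < 1" "t * t = 1 - \<epsilon>" using \<epsilon> by (simp_all add: t_def)
  then have tt: "0 < t * (1 - t)" by simp
  have "K_eps a b \<epsilon> < wandering_bound \<epsilon> \<longleftrightarrow> K_eps a b \<epsilon> * (t * (1 - t)) < \<epsilon> ^ 3"
    unfolding wandering_bound_def t_def[symmetric] by (rule pos_less_divide_eq[OF tt])
  also have "\<dots> \<longleftrightarrow> t * (1 - t) < \<epsilon> ^ 3 / K_eps a b \<epsilon>"
    by (simp add: pos_less_divide_eq[OF K] mult.commute)
  also have "\<dots> \<longleftrightarrow> t < t * t + \<epsilon> ^ 3 / K_eps a b \<epsilon>"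
    by (auto simp: algebra_simps)
  also have "\<dots> \<longleftrightarrow> 1 < (t * t + \<epsilon> ^ 3 / K_eps a b \<epsilon>) / t"
    using t(1) by (simp add: pos_less_divide_eq)
  finally show ?thesis unfolding t(3) by (simp add: t_def)
qed

lemma not_bounded_eig_seq_dual_weight:
  assumes "K_eps a b \<epsilon> < wandering_bound \<epsilon>"
  shows "\<not> bounded (range (eig_seq (dual_weights (weight a b \<epsilon>))))"
proof
  assume bd: "bounded (range (eig_seq (dual_weights (weight a b \<epsilon>))))"
  have "weight a b \<epsilon> 1 / weight a b \<epsilon> 0 > 0"
    using weights_pos[OF bounded_weights_weight] by simp
  from not_bounded_power_over_sqrt_p_poly[OF assms[unfolded wandering_ratio_iff] this]
    bounded_range_Suc[OF bd]
  show False unfolding eig_seq_dual_weight by blast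
qed

lemma summable_eig_seq_dual_weight:
  assumes "\<not> K_eps a b \<epsilon> < wandering_bound \<epsilon>"
  shows "summable (\<lambda>n. (eig_seq (dual_weights (weight a b \<epsilon>)) n)\<^sup>2)"
proof (subst summable_Suc_iff[symmetric], rule summable_comparison_test')
  define c where "c = weight a b \<epsilon> 1 / weight a b \<epsilon> 0"
  define r where "r = (1 - \<epsilon> + \<epsilon> ^ 3 / K_eps a b \<epsilon>) / sqrt (1 - \<epsilon>)"
  show "summable (\<lambda>n. c\<^sup>2 * (1 / p_poly a b n))"
    by (intro summable_mult summable_inverse_p_poly)
  fix n
  have "0 \<le> r" using \<epsilon> K by (simp add: r_def)
  moreover have "r \<le> 1" using assms unfolding wandering_ratio_iff r_def by simp
  ultimately have "(r ^ n)\<^sup>2 \<le> 1" by (intro power_le_one) auto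
  then have "c\<^sup>2 * (r ^ n)\<^sup>2 / p_poly a b n \<le> c\<^sup>2 * 1 / p_poly a b n"
    using p_poly_pos[of n] by (intro divide_right_mono mult_left_mono) (auto simp: less_imp_le)
  then show "norm ((eig_seq (dual_weights (weight a b \<epsilon>)) (Suc n))\<^sup>2) \<le> c\<^sup>2 * (1 / p_poly a b n)"
    using p_poly_pos[of n]
    unfolding eig_seq_dual_weight c_def[symmetric] r_def[symmetric]
    by (simp add: power_mult_distrib power_divide)
qed

lemma analytic_weight: "analytic_op (wshift (weight a b \<epsilon>))"
  by (rule analytic_wshift[OF bounded_weights_weight])
    (use summable_square_imp_bounded not_bounded_eig_seq_weight in blast)

text \<open>All entries of the Gram diagonal except entry 0 are ratios of successive values of the
  increasing p, so entry 0 decides.\<close>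

lemma norm_increasing_weight_iff:
  "norm_increasing (wshift (weight a b \<epsilon>)) \<longleftrightarrow> K_eps a b \<epsilon> \<le> \<epsilon>\<^sup>2"
proof -
  have "norm_increasing (wshift (weight a b \<epsilon>)) \<longleftrightarrow> 1 \<le> gram (weight a b \<epsilon>) 0"
    unfolding norm_increasing_wshift_iff[OF bounded_range_weights[OF bounded_weights_weight]]
    using gram_weight_Suc one_le_p_poly_ratio
    by (metis not0_implies_Suc)
  also have "\<dots> \<longleftrightarrow> \<epsilon> \<le> \<epsilon> ^ 3 / K_eps a b \<epsilon>"
    unfolding gram_weight_0 by auto
  also have "\<dots> \<longleftrightarrow> \<epsilon> * K_eps a b \<epsilon> \<le> \<epsilon> * \<epsilon>\<^sup>2"
    by (simp add: pos_le_divide_eq[OF K] power3_eq_cube power2_eq_square mult_ac)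
  finally show ?thesis using \<epsilon> by simp
qed

lemma wandering_property_weight_iff:
  "wandering_property (wshift (weight a b \<epsilon>)) \<longleftrightarrow> K_eps a b \<epsilon> < wandering_bound \<epsilon>"
  using wandering_property_wshift[OF bounded_weights_weight not_bounded_eig_seq_dual_weight]
    not_wandering_property_wshift[OF bounded_weights_weight summable_eig_seq_dual_weight] by blast

text \<open>Analyticity of the dual is governed by its own eigensequence, its wandering property by
  that of the original operator, which is always unbounded. So the inequality enters only through
  analyticity; if it fails, square-summability excludes a decomposition.\<close>

lemma wold_type_dual_weight_iff:
  "wold_type_decomposition (cauchy_dual (wshift (weight a b \<epsilon>))) \<longleftrightarrow>
    K_eps a b \<epsilon> < wandering_bound \<epsilon>"
  unfolding cauchy_dual_wshift[OF bounded_weights_weight]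
proof
  note dual = bounded_weights_dual[OF bounded_weights_weight]
  assume *: "K_eps a b \<epsilon> < wandering_bound \<epsilon>"
  have "analytic_op (wshift (dual_weights (weight a b \<epsilon>)))"
    by (rule analytic_wshift[OF dual])
      (use summable_square_imp_bounded not_bounded_eig_seq_dual_weight[OF *] in blast)
  moreover have "wandering_property (wshift (dual_weights (weight a b \<epsilon>)))"
    by (rule wandering_property_wshift[OF dual])
      (simp add: dual_dual_weights[OF bounded_weights_weight] not_bounded_eig_seq_weight)
  ultimately show "wold_type_decomposition (wshift (dual_weights (weight a b \<epsilon>)))"
    by (rule wold_type_wshift[OF dual])
next
  assume "wold_type_decomposition (wshift (dual_weights (weight a b \<epsilon>)))"
  then show "K_eps a b \<epsilon> < wandering_bound \<epsilon>"
    using not_wold_type_wshift[OF bounded_weights_dual[OF bounded_weights_weight] summable_eig_seq_dual_weight] by blast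
qed

text \<open>Amounts to \<open>t * (1 - t) < \<epsilon>\<close>, where the gap is
  \<open>1 - t\<close> because \<epsilon> = 1 - t^2. Combined with the criterion for being
  norm-increasing, it gives (v).\<close>

lemma power2_less_wandering_bound: "\<epsilon>\<^sup>2 < wandering_bound \<epsilon>"
proof -
  define t where "t = sqrt (1 - \<epsilon>)"
  have t: "0 < t" "t < 1" "t * t = 1 - \<epsilon>" using \<epsilon> by (simp_all add: t_def)
  have "0 < (1 - t) * 1" using t by simp
  also have "(1 - t) * 1 = \<epsilon> - t * (1 - t)" using t(3) by (simp add: algebra_simps)
  finally have "\<epsilon>\<^sup>2 * (t * (1 - t)) < \<epsilon>\<^sup>2 * \<epsilon>" using \<epsilon> by simp
  then show ?thesis
    using t unfolding wandering_bound_def t_def[symmetric]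
    by (simp add: pos_less_divide_eq power3_eq_cube power2_eq_square)
qed

lemma norm_wshift_weight_basis_0:
  "(norm (wshift (weight a b \<epsilon>) (basis_ell2 0)))\<^sup>2 = 1 - \<epsilon> + \<epsilon> ^ 3 / K_eps a b \<epsilon>"
  by (simp only: norm_wshift_basis_0[OF bounded_weights_weight] gram_weight_0)

end

end

section \<open>Small \<epsilon> and assembly of the statements\<close>

lemma admissible_imp_K_eps_pos:
  assumes "admissible a b \<epsilon>0" "0 < \<epsilon>" "\<epsilon> < \<epsilon>0"
  shows "K_eps a b \<epsilon> > 0" and "\<epsilon> < 1"
proof -
  have "\<epsilon> + b * (2 / \<epsilon> - 1) > a" using assms by (simp add: admissible_def)
  then have "\<epsilon> * (\<epsilon> + b * (2 / \<epsilon> - 1)) > \<epsilon> * a" using assms by simp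
  also have "\<epsilon> * (\<epsilon> + b * (2 / \<epsilon> - 1)) = \<epsilon>\<^sup>2 + 2 * b - \<epsilon> * b"
    using assms by (simp add: field_simps power2_eq_square)
  finally show "K_eps a b \<epsilon> > 0" by (simp add: K_eps_def algebra_simps)
  show "\<epsilon> < 1" using assms by (simp add: admissible_def)
qed

text \<open>Near 0 the left side behaves like 2 \<epsilon>^2, while the right side tends to 2 b >
  0.\<close>

lemma eventually_wandering_bound_less_K_eps:
  assumes "b > 0"
  shows "eventually (\<lambda>\<epsilon>. wandering_bound \<epsilon> < K_eps a b \<epsilon>) (at_right 0)"
  unfolding wandering_bound_def K_eps_def using assms by real_asymp

text \<open>The filter \<open>at_left 1\<close> encodes convergence from below: the last term is of
  order \<epsilon>^3 and cannot compensate the linear term.\<close>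

lemma filterlim_gram_weight_0:
  assumes "b > 0"
  shows "filterlim (\<lambda>\<epsilon>. 1 - \<epsilon> + \<epsilon> ^ 3 / K_eps a b \<epsilon>) (at_left 1) (at_right 0)"
  unfolding K_eps_def using assms by real_asymp

theorem mainTheorem1:
  fixes a b :: real
  assumes "a > 0" and "b > 0"
  shows "(\<exists>\<epsilon>0. admissible a b \<epsilon>0) \<and>
    (\<forall>\<epsilon>0. admissible a b \<epsilon>0 \<longrightarrow>
      (\<forall>\<epsilon>\<in>{0<..<\<epsilon>0}.
        K_eps a b \<epsilon> > 0 \<and>
        (\<forall>f. nth_ell2 (S_eps a b \<epsilon> f) 0 = complex_of_real (weight a b \<epsilon> 0) * nth_ell2 f 0 \<and>
          (\<forall>n\<ge>1. nth_ell2 (S_eps a b \<epsilon> f) n =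
            complex_of_real (weight a b \<epsilon> n) * nth_ell2 f (n - 1))) \<and>
        S_eps a b \<epsilon> (basis_ell2 0) =
          weight a b \<epsilon> 0 *\<^sub>R basis_ell2 0 + weight a b \<epsilon> 1 *\<^sub>R basis_ell2 1 \<and>
        (\<forall>n\<ge>1. S_eps a b \<epsilon> (basis_ell2 n) = weight a b \<epsilon> (n + 1) *\<^sub>R basis_ell2 (n + 1)) \<and>
        bounded_clinear (S_eps a b \<epsilon>) \<and>
        left_invertible (S_eps a b \<epsilon>) \<and>
        cyclic_vector (S_eps a b \<epsilon>) (basis_ell2 0) \<and>
        (\<forall>f. cinner f (basis_ell2 0) = 0 \<longrightarrow> norm (S_eps a b \<epsilon> f) \<ge> norm f) \<and>
        (analytic_op (S_eps a b \<epsilon>) \<and> three_isometry (S_eps a b \<epsilon>)) \<and>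
        (norm_increasing (S_eps a b \<epsilon>) \<longleftrightarrow> K_eps a b \<epsilon> \<le> \<epsilon>\<^sup>2) \<and>
        (wandering_property (S_eps a b \<epsilon>) \<longleftrightarrow> K_eps a b \<epsilon> < wandering_bound \<epsilon>) \<and>
        (wold_type_decomposition (cauchy_dual (S_eps a b \<epsilon>)) \<longleftrightarrow> K_eps a b \<epsilon> < wandering_bound \<epsilon>) \<and>
        (norm_increasing (S_eps a b \<epsilon>) \<longrightarrow> wandering_property (S_eps a b \<epsilon>)) \<and>
        (norm (S_eps a b \<epsilon> (basis_ell2 0)))\<^sup>2 = 1 - \<epsilon> + \<epsilon> ^ 3 / K_eps a b \<epsilon>) \<and>
      (\<exists>\<epsilon>1\<in>{0<..<\<epsilon>0}. \<forall>\<epsilon>\<in>{0<..<\<epsilon>1}.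
        analytic_op (S_eps a b \<epsilon>) \<and> three_isometry (S_eps a b \<epsilon>) \<and> \<not> wandering_property (S_eps a b \<epsilon>)) \<and>
      filterlim (\<lambda>\<epsilon>. (norm (S_eps a b \<epsilon> (basis_ell2 0)))\<^sup>2) (at_left 1) (at_right 0))"
proof (intro conjI allI impI admissible_exists assms, goal_cases)
  case (1 \<epsilon>0)
  note adm = this
  show ?case unfolding S_eps_eq_wshift
  proof (rule ballI, goal_cases)
    case (1 \<epsilon>)
    then have \<epsilon>: "0 < \<epsilon>" "\<epsilon> < 1" and K: "K_eps a b \<epsilon> > 0"
      using admissible_imp_K_eps_pos[OF adm] by auto
    note bww = bounded_weights_weight[OF assms \<epsilon> K]
    note bw = bounded_range_weights[OF bww]
    have "wshift (weight a b \<epsilon>) (basis_ell2 n) = weight a b \<epsilon> (n + 1) *\<^sub>R basis_ell2 (n + 1)"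
      if "n \<ge> 1" for n
      using wshift_basis_Suc[OF bww, of "n - 1"] that by simp
    moreover have "norm f \<le> norm (wshift (weight a b \<epsilon>) f)" if "cinner f (basis_ell2 0) = 0" for f
      using that one_le_p_poly_ratio[OF assms]
      by (intro norm_wshift_ge[OF bww])
        (simp_all add: gram_weight_Suc[OF assms \<epsilon> K] cinner_basis_right)
    moreover have "norm_increasing (wshift (weight a b \<epsilon>)) \<longrightarrow>
        wandering_property (wshift (weight a b \<epsilon>))"
      unfolding norm_increasing_weight_iff[OF assms \<epsilon> K] wandering_property_weight_iff[OF assms \<epsilon> K]
      using power2_less_wandering_bound[OF assms \<epsilon> K] by simp
    ultimately show ?case
      by (intro conjI allI impI K wshift_basis_0[OF bww] bounded_clinear_wshift[OF bw]
          left_invertible_wshift[OF bww] cyclic_vector_wshift[OF bww]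
          analytic_weight[OF assms \<epsilon> K] three_isometry_weight[OF assms \<epsilon> K]
          norm_increasing_weight_iff[OF assms \<epsilon> K] wandering_property_weight_iff[OF assms \<epsilon> K]
          wold_type_dual_weight_iff[OF assms \<epsilon> K] norm_wshift_weight_basis_0[OF assms \<epsilon> K])
        (simp_all add: nth_wshift[OF bw])
  qed
next
  case (2 \<epsilon>0)
  note adm = this
  have "eventually (\<lambda>\<epsilon>. wandering_bound \<epsilon> < K_eps a b \<epsilon> \<and> \<epsilon> < \<epsilon>0) (at_right 0)"
    using adm eventually_at_right_real[of 0 \<epsilon>0]
    by (intro eventually_conj eventually_wandering_bound_less_K_eps assms)
      (auto simp: admissible_def elim: eventually_mono)
  then obtain d where d: "d > 0"
    "\<And>\<epsilon>. 0 < \<epsilon> \<Longrightarrow> \<epsilon> < d \<Longrightarrow> wandering_bound \<epsilon> < K_eps a b \<epsilon> \<and> \<epsilon> < \<epsilon>0"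
    unfolding eventually_at_right_field by blast
  show ?case unfolding S_eps_eq_wshift
  \<comment> \<open>Halving \<open>d\<close> matters for membership: the property at
    \<open>d / 2\<close> itself supplies \<open>d / 2 < \<epsilon>0\<close>.\<close>
  proof (intro bexI[of _ "d / 2"] ballI, goal_cases)
    case (1 \<epsilon>)
    then have *: "0 < \<epsilon>" "\<epsilon> < d" using d(1) by auto
    then have \<epsilon>: "0 < \<epsilon>" "\<epsilon> < 1" and K: "K_eps a b \<epsilon> > 0"
      using d(2) admissible_imp_K_eps_pos[OF adm] by auto
    show ?case
      unfolding wandering_property_weight_iff[OF assms \<epsilon> K]
      using analytic_weight[OF assms \<epsilon> K] three_isometry_weight[OF assms \<epsilon> K] d(2)[OF *] by simp
  next
    case 2
    show ?case using d(1) d(2)[of "d / 2"] by simp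
  qed
next
  case (3 \<epsilon>0)
  \<comment> \<open>The norm formula is available for \<epsilon> below \<open>\<epsilon>0\<close>,
    which suffices for a limit at 0 from the right.\<close>
  have "eventually (\<lambda>\<epsilon>. 1 - \<epsilon> + \<epsilon> ^ 3 / K_eps a b \<epsilon> = (norm (S_eps a b \<epsilon> (basis_ell2 0)))\<^sup>2)
      (at_right 0)"
  proof (rule eventually_mono)
    show "eventually (\<lambda>\<epsilon>. \<epsilon> \<in> {0<..<\<epsilon>0}) (at_right 0)"
      using 3 by (intro eventually_at_right_real) (simp add: admissible_def)
    show "1 - \<epsilon> + \<epsilon> ^ 3 / K_eps a b \<epsilon> = (norm (S_eps a b \<epsilon> (basis_ell2 0)))\<^sup>2"
      if "\<epsilon> \<in> {0<..<\<epsilon>0}" for \<epsilon>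
      using that norm_wshift_weight_basis_0[OF assms] admissible_imp_K_eps_pos[OF 3]
      unfolding S_eps_eq_wshift by auto
  qed
  from filterlim_cong[OF refl refl this, THEN iffD1] filterlim_gram_weight_0[OF assms(2)]
  show ?case by blast
qed

end
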